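(* Let $\mathbb D=\{z\in\mathbb R^2:|z|<1\}$ and let $\varphi:\partial\mathbb D\to\mathbb R$ be a continuous function. Then there exists a spacelike entire graph in $\mathbb R^{2,1}$ whose principal curvatures are bounded from below by a positive constant and whose support function $u$ extends $\varphi$ if and only if $\varphi$ is in the Zygmund class.
   Context: Minkowski space $\mathbb R^{2,1}$ is $\mathbb R^3$ with $\langle x,y\rangle=x^1y^1+x^2y^2-x^3y^3$. All entire graphs considered are convex: a spacelike entire graph is a surface $S=\{(p,f(p)) : p\in\mathbb R^2\}$ with $f:\mathbb R^2\to\mathbb R$ a convex $C^1$ function such that $\|Df(p)\|<1$ for all $p$. Its support function is $u(z)=\sup_{p\in S}\langle p,(z,1)\rangle$ for $z\in\mathbb D$ (a convex function). When $S$ is $C^2$, its shape operator is $B(v)=\nabla_vN$, where $N$ is the future unit normal field ($\langle N,N\rangle=-1$, $N^3>0$) and $\nabla$ is the flat connection of $\mathbb R^{2,1}$; the principal curvatures are the eigenvalues of $B$ (they are nonnegative for convex $f$). Statements about principal curvatures refer to surfaces regular enough for $B$ to be defined. A convex function $u:\mathbb D\to\mathbb R$ extends $\varphi$ if $\varphi(z_0)=\liminf_{z\to z_0}u(z)$ for every $z_0\in\partial\mathbb D$ (for continuous $\varphi$ this is equivalent to $u$ being continuous up to the boundary with boundary value $\varphi$). A function $\varphi:\partial\mathbb D\to\mathbb R$ is in the Zygmund class if there is a constant $C$ such that $|\varphi(e^{i(\theta+h)})+\varphi(e^{i(\theta-h)})-2\varphi(e^{i\theta})|\le C|h|$ for all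 $\theta,h\in\mathbb R$. *)

theory Defs
  imports "HOL-Analysis.Analysis"
begin

text \<open>The plane \<open>\<real>\<^sup>2\<close> is \<^typ>\<open>complex\<close> with its Euclidean inner product, so that
  \<open>e\<^sup>i\<^sup>\<theta>\<close> is \<^term>\<open>cis \<theta>\<close>; Minkowski space \<open>\<real>\<^sup>2\<^sup>,\<^sup>1\<close> is the product of the plane with the time axis.\<close>

type_synonym minkowski = "complex \<times> real"

definition mink :: "minkowski \<Rightarrow> minkowski \<Rightarrow> real" where
  "mink x y = Re (fst x) * Re (fst y) + Im (fst x) * Im (fst y) - snd x * snd y"

definition C1 :: "('a::real_normed_vector \<Rightarrow> 'b::real_normed_vector) \<Rightarrow> bool" where
  "C1 f \<longleftrightarrow> (\<exists>f' :: 'a \<Rightarrow> 'a \<Rightarrow>\<^sub>L 'b.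
     (\<forall>x. (f has_derivative blinfun_apply (f' x)) (at x)) \<and> continuous_on UNIV f')"

definition C2 :: "('a::real_normed_vector \<Rightarrow> 'b::real_normed_vector) \<Rightarrow> bool" where
  "C2 f \<longleftrightarrow> (\<exists>f' :: 'a \<Rightarrow> 'a \<Rightarrow>\<^sub>L 'b.
     (\<forall>x. (f has_derivative blinfun_apply (f' x)) (at x)) \<and> C1 f')"

definition entire_graph :: "(complex \<Rightarrow> real) \<Rightarrow> minkowski set" where
  "entire_graph f = {(p, f p) | p. True}"

definition spacelike_entire :: "(complex \<Rightarrow> real) \<Rightarrow> bool" where
  "spacelike_entire f \<longleftrightarrow> convex_on UNIV f \<and> C1 f \<and>
     (\<forall>p. onorm (frechet_derivative f (at p)) < 1)"

definition support_function :: "minkowski set \<Rightarrow> complex \<Rightarrow> ereal" where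
  "support_function S z = (SUP x\<in>S. ereal (mink x (z, 1)))"

text \<open>The tangent plane at \<open>(p, f p)\<close>, as the image of the differential of \<open>p \<mapsto> (p, f p)\<close>.\<close>

definition tangent_plane :: "(complex \<Rightarrow> real) \<Rightarrow> complex \<Rightarrow> minkowski set" where
  "tangent_plane f p = range (\<lambda>w. (w, frechet_derivative f (at p) w))"

definition future_unit_normal :: "(complex \<Rightarrow> real) \<Rightarrow> complex \<Rightarrow> minkowski" where
  "future_unit_normal f p =
     (THE n. (\<forall>v\<in>tangent_plane f p. mink n v = 0) \<and> mink n n = -1 \<and> snd n > 0)"

text \<open>The normal field is parametrised by the base point \<open>p\<close>, so the flat derivative of \<open>N\<close> along
  the tangent vector \<open>v = (w, Df(p) w)\<close> is the derivative of \<^term>\<open>future_unit_normal f\<close>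
  at \<open>p\<close> in the direction \<open>w = fst v\<close>.\<close>

definition shape_operator :: "(complex \<Rightarrow> real) \<Rightarrow> complex \<Rightarrow> minkowski \<Rightarrow> minkowski" where
  "shape_operator f p v = frechet_derivative (future_unit_normal f) (at p) (fst v)"

definition principal_curvatures :: "(complex \<Rightarrow> real) \<Rightarrow> complex \<Rightarrow> real set" where
  "principal_curvatures f p =
     {k. \<exists>v\<in>tangent_plane f p. v \<noteq> 0 \<and> shape_operator f p v = k *\<^sub>R v}"

definition extends_boundary :: "(complex \<Rightarrow> real) \<Rightarrow> (complex \<Rightarrow> real) \<Rightarrow> bool" where
  "extends_boundary u \<phi> \<longleftrightarrow> convex_on (ball 0 1) u \<and>
     (\<forall>z0\<in>sphere 0 1. ereal (\<phi> z0) = Liminf (at z0 within ball 0 1) (\<lambda>z. ereal (u z)))"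

definition zygmund :: "(complex \<Rightarrow> real) \<Rightarrow> bool" where
  "zygmund \<phi> \<longleftrightarrow> (\<exists>C. \<forall>\<theta> h.
     \<bar>\<phi> (cis (\<theta> + h)) + \<phi> (cis (\<theta> - h)) - 2 * \<phi> (cis \<theta>)\<bar> \<le> C * \<bar>h\<bar>)"

end

theory Submission
  imports Defs
begin

text \<open>Write \<open>\<ell>(z) = sqrt (1 - |z|\<^sup>2)\<close>. The convex function \<open>- \<ell>\<close> is the support function of the unit hyperboloid,
an entire graph all of whose principal curvatures are \<open>1\<close>. If \<open>u\<close> is the support function of a graph
\<open>S\<close>, then the Hessian of \<open>u\<close> at \<open>z\<close>, measured against the Hessian of \<open>- \<ell>\<close>, has the
inverses of the principal curvatures of \<open>S\<close> as eigenvalues, taken at the point with normal direction \<open>(z, 1)\<close>.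
So the principal curvatures are at least \<open>c\<close> exactly if \<open>u\<close> is convex and \<open>u + \<ell> / c\<close> is concave, and
the theorem becomes a statement on convex functions on the disc: there is a convex extension \<open>u\<close> of \<open>\<phi>\<close> with
\<open>u + K \<ell>\<close> concave for some \<open>K\<close> if and only if \<open>\<phi>\<close> is Zygmund.

Necessity is elementary (\<open>zygmund_if_pinched\<close>). The chord between \<open>cis (\<theta> + h)\<close> and \<open>cis (\<theta> - h)\<close> has the midpoint
\<open>cos h cis \<theta>\<close>, which also lies on the radius to \<open>cis \<theta>\<close>, and there \<open>\<ell> = |sin h|\<close>. Convexity of \<open>u\<close> and
concavity of \<open>u + K \<ell>\<close>, along the chord and along the radius, pin \<open>u\<close> at this point within \<open>O(h)\<close> both to
the mean of the two outer boundary values and to \<open>\<phi> (cis \<theta>)\<close>. The passage from the graph to \<open>u\<close>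
(\<open>support_function_pinched\<close>) needs the gradient of \<open>f\<close> to be onto the disc, which holds
because \<open>u\<close> is finite there, and the symmetry of the Hessian, which turns a bound on the eigenvalues into a bound on the
quadratic form.

For sufficiency, \<open>\<phi>\<close> is smoothed at the scale \<open>e\<close> comparable to \<open>\<ell>\<close>: at the point with argument \<open>\<theta>\<close> the
value is the average of \<open>\<phi>\<close> around \<open>\<theta>\<close> against a triangular kernel of width \<open>e\<close>, that is, the second difference of a
second primitive of \<open>\<phi>\<close> divided by \<open>e\<^sup>2\<close>. For a Zygmund function the second derivatives of this smoothing are smaller by
one power of \<open>e\<close> than for a merely bounded function, which leaves the powers found in the Hessian of
\<open>- \<ell>\<close>, whose radial part is of order \<open>\<ell>\<^sup>-\<^sup>3\<close> and whose tangential part is of order \<open>\<ell>\<^sup>-\<^sup>1\<close>. Hence the smoothing has a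
Hessian bounded by \<open>K\<close> times that of \<open>- \<ell>\<close> (\<open>hess_extension_bound\<close>), and adding \<open>(K + 1) (- \<ell>)\<close>
gives a support function with Hessian pinched between two multiples of that of \<open>- \<ell>\<close>. Its Legendre transform is the graph
(\<open>entire_graph_with_support_function\<close>).\<close>

section \<open>Gradients of convex functions and the Legendre transform\<close>

lemma has_derivative_along_line:
  fixes x y :: "'a::real_normed_vector"
  assumes "(F has_derivative F') (at (x + t *\<^sub>R (y - x)))"
  shows "((\<lambda>t. F (x + t *\<^sub>R (y - x))) has_derivative (\<lambda>s. F' (s *\<^sub>R (y - x)))) (at t)"
proof -
  have "((\<lambda>t. x + t *\<^sub>R (y - x)) has_derivative (\<lambda>s. s *\<^sub>R (y - x))) (at t)"
    by (auto intro!: derivative_eq_intros)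
  from has_derivative_compose[OF this assms] show ?thesis .
qed

lemma segment_mem:
  fixes x y :: "'a::real_vector"
  assumes "convex S" "x \<in> S" "y \<in> S" "0 \<le> t" "t \<le> 1"
  shows "x + t *\<^sub>R (y - x) \<in> S"
proof -
  have "x + t *\<^sub>R (y - x) = (1 - t) *\<^sub>R x + t *\<^sub>R y" by (simp add: algebra_simps)
  then show ?thesis using convexD_alt[of S x y t] assms by (simp add: add.commute)
qed

lemma gradient_DERIV_along_line:
  fixes x y :: "'a::real_inner"
  assumes "(g has_derivative A) (at (x + t *\<^sub>R (y - x)))"
  shows "((\<lambda>t. inner (g (x + t *\<^sub>R (y - x))) (y - x)) has_real_derivative inner (A (y - x)) (y - x)) (at t)"
proof -
  interpret bounded_linear A using assms by (rule has_derivative_bounded_linear)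
  show ?thesis
    unfolding has_field_derivative_def
    by (rule has_derivative_eq_rhs[OF has_derivative_inner[OF has_derivative_along_line[OF assms]
          has_derivative_const[of "y - x"]]])
      (simp add: scaleR mult.commute fun_eq_iff)
qed

lemma function_DERIV_along_line:
  fixes x y :: "'a::real_inner"
  assumes "(u has_derivative inner a) (at (x + t *\<^sub>R (y - x)))"
  shows "((\<lambda>t. u (x + t *\<^sub>R (y - x))) has_real_derivative inner a (y - x)) (at t)"
  unfolding has_field_derivative_def
  by (rule has_derivative_eq_rhs[OF has_derivative_along_line[OF assms]])
    (simp add: mult.commute fun_eq_iff)

text \<open>Monotonicity of the gradient and the subgradient inequality are one-dimensional facts along the segment; stated for a gradient
field and its derivative, they apply alike to the graph function, to its support function and to their differences
with the model.\<close>

lemma gradient_monotone: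
  fixes g :: "'a::real_inner \<Rightarrow> 'a"
  assumes "convex S" and A: "\<And>x. x \<in> S \<Longrightarrow> (g has_derivative A x) (at x)"
    and pos: "\<And>x w. x \<in> S \<Longrightarrow> 0 \<le> inner w (A x w)" and "x \<in> S" "y \<in> S"
  shows "0 \<le> inner (g y - g x) (y - x)"
proof -
  let ?d = "\<lambda>t. inner (g (x + t *\<^sub>R (y - x))) (y - x)"
  have "?d 0 \<le> ?d 1"
  proof (rule DERIV_nonneg_imp_nondecreasing[of 0 1 ?d])
    fix t :: real assume "0 \<le> t" "t \<le> 1"
    then have "x + t *\<^sub>R (y - x) \<in> S" using assms segment_mem by blast
    from gradient_DERIV_along_line[OF A[OF this]] pos[OF this]
    show "\<exists>z. (?d has_real_derivative z) (at t) \<and> z \<ge> 0" by (metis inner_commute)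
  qed simp
  then show ?thesis by (simp add: inner_diff_left)
qed

lemma gradient_strictly_monotone:
  fixes g :: "'a::real_inner \<Rightarrow> 'a"
  assumes "convex S" and A: "\<And>x. x \<in> S \<Longrightarrow> (g has_derivative A x) (at x)"
    and pos: "\<And>x w. x \<in> S \<Longrightarrow> w \<noteq> 0 \<Longrightarrow> 0 < inner w (A x w)" and "x \<in> S" "y \<in> S" "x \<noteq> y"
  shows "0 < inner (g y - g x) (y - x)"
proof -
  let ?d = "\<lambda>t. inner (g (x + t *\<^sub>R (y - x))) (y - x)"
  have "?d 0 < ?d 1"
  proof (rule DERIV_pos_imp_increasing[of 0 1 ?d])
    fix t :: real assume "0 \<le> t" "t \<le> 1"
    then have "x + t *\<^sub>R (y - x) \<in> S" using assms segment_mem by blast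
    from gradient_DERIV_along_line[OF A[OF this]] pos[OF this, of "y - x"] \<open>x \<noteq> y\<close>
    show "\<exists>z. (?d has_real_derivative z) (at t) \<and> z > 0" by (metis inner_commute right_minus_eq)
  qed simp
  then show ?thesis by (simp add: inner_diff_left)
qed

lemma subgradient_inequality:
  fixes u :: "'a::real_inner \<Rightarrow> real"
  assumes "convex S" and g: "\<And>x. x \<in> S \<Longrightarrow> (u has_derivative inner (g x)) (at x)"
    and A: "\<And>x. x \<in> S \<Longrightarrow> (g has_derivative A x) (at x)"
    and pos: "\<And>x w. x \<in> S \<Longrightarrow> 0 \<le> inner w (A x w)" and "x \<in> S" "y \<in> S"
  shows "u x + inner (g x) (y - x) \<le> u y"
proof -
  let ?p = "\<lambda>t. x + t *\<^sub>R (y - x)"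
  let ?d = "\<lambda>t. u (?p t) - t * inner (g x) (y - x)"
  have "?d 0 \<le> ?d 1"
  proof (rule DERIV_nonneg_imp_nondecreasing[of 0 1 ?d])
    fix t :: real assume t: "0 \<le> t" "t \<le> 1"
    then have S: "?p t \<in> S" using assms segment_mem by blast
    have d: "(?d has_real_derivative inner (g (?p t)) (y - x) - inner (g x) (y - x)) (at t)"
      using function_DERIV_along_line[OF g[OF S]] by (auto intro!: derivative_eq_intros)
    have "0 \<le> inner (g (?p t) - g x) (?p t - x)"
      using \<open>x \<in> S\<close> S by (intro gradient_monotone[of S g A]) (use assms in auto)
    then have "0 \<le> t * inner (g (?p t) - g x) (y - x)" by simp
    then have "t = 0 \<or> 0 \<le> inner (g (?p t) - g x) (y - x)"
      using t by (auto simp: zero_le_mult_iff)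
    then have "0 \<le> inner (g (?p t) - g x) (y - x)" by auto
    then show "\<exists>z. (?d has_real_derivative z) (at t) \<and> z \<ge> 0"
      using d by (auto simp: inner_diff_left)
  qed simp
  then show ?thesis by (simp add: algebra_simps)
qed

text \<open>A function with an affine minorant touching it at each point is a supremum of affine functions.\<close>

lemma convex_on_if_subgradients:
  fixes u :: "'a::real_inner \<Rightarrow> real"
  assumes S: "convex S" and g: "\<And>x y. x \<in> S \<Longrightarrow> y \<in> S \<Longrightarrow> u x + inner (g x) (y - x) \<le> u y"
  shows "convex_on S u"
proof (rule convex_onI[OF _ S])
  fix t :: real and x y assume t: "t > 0" "t < 1" and xy: "x \<in> S" "y \<in> S"
  define m where "m = (1 - t) *\<^sub>R x + t *\<^sub>R y"
  have "m \<in> S" using convexD_alt[OF S xy, of t] t by (simp add: m_def)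
  have "(1 - t) * (u m + inner (g m) (x - m)) + t * (u m + inner (g m) (y - m)) \<le> (1 - t) * u x + t * u y"
    using t g[OF \<open>m \<in> S\<close> xy(1)] g[OF \<open>m \<in> S\<close> xy(2)] by (intro add_mono mult_left_mono) auto
  moreover have "(1 - t) * inner (g m) (x - m) + t * inner (g m) (y - m) = inner (g m) ((1 - t) *\<^sub>R (x - m) + t *\<^sub>R (y - m))"
    by (simp add: inner_add_right)
  moreover have "(1 - t) *\<^sub>R (x - m) + t *\<^sub>R (y - m) = 0"
    by (simp add: m_def algebra_simps)
  ultimately show "u ((1 - t) *\<^sub>R x + t *\<^sub>R y) \<le> (1 - t) * u x + t * u y"
    by (simp add: m_def algebra_simps)
qed

lemma gradient_at_interior_maximum:
  fixes u :: "'a::euclidean_space \<Rightarrow> real"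
  assumes "open S" "x \<in> S" "(u has_derivative inner a) (at x)"
    and "\<And>y. y \<in> S \<Longrightarrow> inner p y - u y \<le> inner p x - u x"
  shows "a = p"
proof -
  have "((\<lambda>y. inner p y - u y) has_derivative (\<lambda>w. inner p w - inner a w)) (at x)"
    by (auto intro!: derivative_eq_intros assms)
  then have "(\<lambda>w. inner p w - inner a w) = (\<lambda>v. 0)"
    using assms by (intro differential_zero_maxmin[of x S]) auto
  then show ?thesis by (metis inner_diff_left inner_eq_zero_iff right_minus_eq)
qed

lemma positive_definite_inverse:
  fixes A :: "'a::euclidean_space \<Rightarrow> 'a"
  assumes "linear A" and pos: "\<And>w. w \<noteq> 0 \<Longrightarrow> 0 < inner w (A w)"
  shows "A (inv A w) = w" "inv A (A w) = w" "linear (inv A)"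
proof -
  have "inj A"
    using assms by (subst linear_injective_0) (metis inner_zero_right less_irrefl)+
  then have "surj A" using assms linear_injective_imp_surjective by blast
  show "A (inv A w) = w" using \<open>surj A\<close> by (rule surj_f_inv_f)
  show "inv A (A w) = w" using \<open>inj A\<close> by (rule inv_f_f)
  show "linear (inv A)" using assms \<open>inj A\<close> \<open>surj A\<close>
    by (metis linear_injective_left_inverse bij_betw_def inj_imp_surj_inv inv_unique_comp linear_surjective_right_inverse
        linear_injective_isomorphism o_def fun_eq_iff inv_f_f surj_f_inv_f)
qed

text \<open>The Legendre transform \<open>p \<mapsto> p \<bullet> Z p - u (Z p)\<close>, with \<open>Z\<close> the inverse of the gradient of \<open>u\<close>, has gradient \<open>Z\<close>:
in the product rule the two terms with the derivative of \<open>Z\<close> cancel because \<open>g (Z p) = p\<close>. Both directions of the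
theorem use this, once from graph to support function and once back.\<close>

lemma legendre_derivatives:
  fixes u :: "'a::euclidean_space \<Rightarrow> real"
  assumes S: "open S" "x \<in> S" and u: "(u has_derivative inner (g x)) (at x)"
    and A: "\<And>x. x \<in> S \<Longrightarrow> (g has_derivative A x) (at x)"
    and pos: "\<And>w. w \<noteq> 0 \<Longrightarrow> 0 < inner w (A x w)"
    and Z: "\<And>x. x \<in> S \<Longrightarrow> Z (g x) = x"
  shows "(Z has_derivative inv (A x)) (at (g x))"
    and "((\<lambda>p. inner p (Z p) - u (Z p)) has_derivative inner x) (at (g x))"
proof -
  have lin: "linear (A x)"
    using A[OF S(2)] by (simp add: bounded_linear.linear has_derivative_bounded_linear)
  note inv = positive_definite_inverse[OF lin pos]
  show dZ: "(Z has_derivative inv (A x)) (at (g x))"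
  proof (rule has_derivative_inverse_strong[OF S])
    show "continuous_on S g"
      using A by (meson continuous_at_imp_continuous_on has_derivative_continuous)
    show "A x \<circ> inv (A x) = id" using inv by auto
  qed (use A Z S in auto)
  have "(u has_derivative inner (g x)) (at (Z (g x)))" using u Z S by simp
  from has_derivative_compose[OF dZ this]
  have "((\<lambda>p. u (Z p)) has_derivative (\<lambda>w. inner (g x) (inv (A x) w))) (at (g x))" .
  then have "((\<lambda>p. inner p (Z p) - u (Z p)) has_derivative
     (\<lambda>w. inner (g x) (inv (A x) w) + inner w (Z (g x)) - inner (g x) (inv (A x) w))) (at (g x))"
    by (auto intro!: derivative_eq_intros dZ)
  then show "((\<lambda>p. inner p (Z p) - u (Z p)) has_derivative inner x) (at (g x))"
    using Z S by (simp add: inner_commute[of _ x])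
qed

section \<open>The hyperboloid\<close>

text \<open>The function \<open>- lapse\<close> is the support function of the unit hyperboloid; its Hessian \<open>hyp_hess z\<close> is, up to the factor
\<open>lapse z\<close>, the hyperbolic metric of the Klein disc. Its inverse \<open>hyp_metric z\<close>
is \<open>lapse z\<close> times the first fundamental form of a graph with gradient \<open>z\<close>.\<close>

definition lapse :: "complex \<Rightarrow> real" where "lapse z = sqrt (1 - (norm z)\<^sup>2)"

definition hyp_hess :: "complex \<Rightarrow> complex \<Rightarrow> complex" where
  "hyp_hess z w = (1 / lapse z) *\<^sub>R w + (inner z w / lapse z ^ 3) *\<^sub>R z"

definition hyp_metric :: "complex \<Rightarrow> complex \<Rightarrow> complex" where
  "hyp_metric z w = lapse z *\<^sub>R (w - inner z w *\<^sub>R z)"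

lemma lapse_pos: "norm z < 1 \<Longrightarrow> 0 < lapse z"
  by (simp add: lapse_def abs_square_less_1)

lemma lapse_le_1: "norm z < 1 \<Longrightarrow> lapse z \<le> 1"
  by (simp add: lapse_def)

lemma lapse_square: "norm z < 1 \<Longrightarrow> (lapse z)\<^sup>2 = 1 - (norm z)\<^sup>2"
  by (simp add: lapse_def abs_square_le_1)

lemma lapse_has_derivative:
  assumes "norm z < 1"
  shows "((\<lambda>z. - lapse z) has_derivative inner ((1 / lapse z) *\<^sub>R z)) (at z)"
proof -
  have pos: "0 < 1 - (inner z z)" using assms by (simp add: abs_square_less_1 flip: power2_norm_eq_inner)
  have "((\<lambda>z. - sqrt (1 - inner z z)) has_derivative inner ((1 / sqrt (1 - inner z z)) *\<^sub>R z)) (at z)"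
    using pos by (auto intro!: derivative_eq_intros simp: fun_eq_iff inner_commute field_simps)
  then show ?thesis by (simp add: lapse_def[abs_def] power2_norm_eq_inner)
qed

lemma hyp_hess_has_derivative:
  assumes "norm z < 1"
  shows "((\<lambda>z. (1 / lapse z) *\<^sub>R z) has_derivative hyp_hess z) (at z)"
proof -
  have d: "(lapse has_derivative (\<lambda>w. - inner ((1 / lapse z) *\<^sub>R z) w)) (at z)"
    using has_derivative_minus[OF lapse_has_derivative[OF assms]] by simp
  show ?thesis
    using lapse_pos[OF assms]
    by (auto intro!: derivative_eq_intros d simp: fun_eq_iff hyp_hess_def field_simps power3_eq_cube power2_eq_square)
qed

lemma hyp_hess_form: "inner w (hyp_hess z w) = (norm w)\<^sup>2 / lapse z + (inner z w)\<^sup>2 / lapse z ^ 3"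
  by (simp add: hyp_hess_def inner_add_right dot_square_norm inner_commute[of w z] power2_eq_square[of "inner z w"])

text \<open>Comparison with the Euclidean metric makes every form that dominates \<open>hyp_hess\<close> invertible, with an inverse of
norm at most \<open>1\<close>.\<close>

lemma hyp_hess_ge:
  assumes "norm z < 1" shows "(norm w)\<^sup>2 \<le> inner w (hyp_hess z w)"
proof -
  have "(norm w)\<^sup>2 \<le> (norm w)\<^sup>2 / lapse z"
    using lapse_pos[OF assms] lapse_le_1[OF assms] by (simp add: mult_left_le_one_le pos_le_divide_eq mult.commute)
  then show ?thesis using lapse_pos[OF assms] unfolding hyp_hess_form
    by (smt (verit) divide_nonneg_pos zero_le_power2 zero_less_power)
qed

lemma linear_hyp_hess: "linear (hyp_hess z)"
  by (rule linearI) (simp_all add: hyp_hess_def algebra_simps inner_add_right add_divide_distrib)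

lemma linear_hyp_metric: "linear (hyp_metric z)"
  by (rule linearI) (simp_all add: hyp_metric_def algebra_simps inner_add_right)

lemma hyp_metric_symmetric: "inner v (hyp_metric z w) = inner (hyp_metric z v) w"
  by (simp add: hyp_metric_def inner_diff_right inner_diff_left inner_commute)

lemma hyp_metric_inverse:
  assumes "norm z < 1"
  shows "hyp_metric z (hyp_hess z w) = w" "hyp_hess z (hyp_metric z w) = w"
proof -
  define s where "s = lapse z"
  have s: "s > 0" using lapse_pos[OF assms] by (simp add: s_def)
  have zz: "inner z z = 1 - s\<^sup>2" using lapse_square[OF assms] by (simp add: s_def power2_norm_eq_inner)
  have e1: "inner z w / s + inner z w / s ^ 3 * inner z z = inner z w / s ^ 3"
    using s unfolding zz by (simp add: field_simps power2_eq_square power3_eq_cube)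
  have "hyp_metric z (hyp_hess z w) = s *\<^sub>R ((1 / s) *\<^sub>R w + (inner z w / s ^ 3) *\<^sub>R z - (inner z w / s + inner z w / s ^ 3 * inner z z) *\<^sub>R z)"
    by (simp add: hyp_metric_def hyp_hess_def inner_add_right flip: s_def)
  then show "hyp_metric z (hyp_hess z w) = w" unfolding e1 using s by simp
  have e2: "(inner z w - inner z w * inner z z) / s ^ 2 = inner z w"
    using s unfolding zz by (simp add: field_simps)
  have "hyp_hess z (hyp_metric z w) = w - inner z w *\<^sub>R z + ((inner z w - inner z w * inner z z) / s ^ 2) *\<^sub>R z"
    using s by (simp add: hyp_metric_def hyp_hess_def inner_diff_right power3_eq_cube power2_eq_square
        flip: s_def right_diff_distrib)
  then show "hyp_hess z (hyp_metric z w) = w" unfolding e2 by simp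
qed

lemma hyp_metric_pos:
  assumes "norm z < 1" "w \<noteq> 0" shows "0 < inner w (hyp_metric z w)"
proof -
  let ?v = "hyp_metric z w"
  have w: "w = hyp_hess z ?v" using hyp_metric_inverse[OF assms(1)] by simp
  then have "?v \<noteq> 0" using assms(2) by (metis linear_0 linear_hyp_hess)
  then have "0 < (norm ?v)\<^sup>2" by simp
  also have "\<dots> \<le> inner ?v w" using hyp_hess_ge[OF assms(1), of ?v] w by simp
  finally show ?thesis by (simp add: inner_commute)
qed

section \<open>Principal curvatures in terms of the gradient\<close>

lemma mink_eq_inner: "mink x y = inner (fst x) (fst y) - snd x * snd y"
  by (simp add: mink_def inner_complex_def)

lemma future_unit_normal_eq:
  assumes G: "(f has_derivative inner a) (at p)" and a: "norm a < 1"
  shows "future_unit_normal f p = ((1 / lapse a) *\<^sub>R a, 1 / lapse a)"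
  unfolding future_unit_normal_def
proof (rule the_equality)
  have fd: "frechet_derivative f (at p) = inner a" using frechet_derivative_at[OF G] by simp
  note s = lapse_pos[OF a] lapse_square[OF a]
  have "(1 / lapse a) * (1 / lapse a) * (inner a a) - (1 / lapse a) * (1 / lapse a) = -1"
    using s by (simp add: dot_square_norm field_simps flip: power2_eq_square)
  then show "(\<forall>v\<in>tangent_plane f p. mink ((1 / lapse a) *\<^sub>R a, 1 / lapse a) v = 0) \<and>
      mink ((1 / lapse a) *\<^sub>R a, 1 / lapse a) ((1 / lapse a) *\<^sub>R a, 1 / lapse a) = -1 \<and>
      0 < snd ((1 / lapse a) *\<^sub>R a, 1 / lapse a)"
    using s by (simp add: tangent_plane_def fd mink_eq_inner algebra_simps)
  fix n assume n: "(\<forall>v\<in>tangent_plane f p. mink n v = 0) \<and> mink n n = -1 \<and> 0 < snd n"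
  have "inner (fst n - snd n *\<^sub>R a) w = 0" for w
    using n by (auto simp: tangent_plane_def fd mink_eq_inner inner_diff_left)
  then have fst: "fst n = snd n *\<^sub>R a" by (metis inner_eq_zero_iff right_minus_eq)
  have "(snd n)\<^sup>2 * (lapse a)\<^sup>2 = 1"
  proof -
    have "mink n n = (snd n)\<^sup>2 * (norm a)\<^sup>2 - (snd n)\<^sup>2"
      by (simp add: mink_eq_inner fst dot_square_norm power2_eq_square)
    then show ?thesis using n unfolding s(2) by (simp add: algebra_simps)
  qed
  then have "snd n * lapse a = 1 \<or> snd n * lapse a = -1"
    by (metis power2_eq_1_iff power_mult_distrib)
  moreover have "0 < snd n * lapse a" using n s by simp
  ultimately have "snd n * lapse a = 1" by linarith
  then have "snd n = 1 / lapse a" using s by (simp add: field_simps)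
  then show "n = ((1 / lapse a) *\<^sub>R a, 1 / lapse a)" using fst by (metis prod.collapse)
qed

text \<open>With \<open>G\<close> the gradient of \<open>f\<close>, the horizontal part of the unit normal is \<open>G / lapse G\<close>, which is the gradient of \<open>- lapse\<close>
taken at \<open>G\<close>. The chain rule therefore gives \<open>hyp_hess (G p) \<circ> B\<close> for the horizontal part of the shape operator.\<close>

lemma principal_curvatures_eq:
  assumes G: "\<And>p. (f has_derivative inner (G p)) (at p)" and a: "\<And>p. norm (G p) < 1"
    and B: "(G has_derivative B) (at p)"
  shows "principal_curvatures f p = {k. \<exists>w. w \<noteq> 0 \<and> hyp_hess (G p) (B w) = k *\<^sub>R w}"
proof -
  define s where "s = lapse (G p)"
  have s: "s > 0" using lapse_pos[OF a] by (simp add: s_def)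
  have fd: "frechet_derivative f (at p) = inner (G p)" using frechet_derivative_at[OF G] by simp
  have N: "future_unit_normal f = (\<lambda>p. ((1 / lapse (G p)) *\<^sub>R G p, 1 / lapse (G p)))"
    using future_unit_normal_eq[OF G a] by auto
  have d1: "((\<lambda>p. (1 / lapse (G p)) *\<^sub>R G p) has_derivative (\<lambda>w. hyp_hess (G p) (B w))) (at p)"
    using has_derivative_compose[OF B hyp_hess_has_derivative[OF a]] .
  have "((\<lambda>p. - lapse (G p)) has_derivative (\<lambda>w. inner ((1 / lapse (G p)) *\<^sub>R (G p)) (B w))) (at p)"
    using has_derivative_compose[OF B lapse_has_derivative[OF a]] .
  from has_derivative_minus[OF this]
  have d2: "((\<lambda>p. lapse (G p)) has_derivative (\<lambda>w. - inner ((1 / lapse (G p)) *\<^sub>R (G p)) (B w))) (at p)"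
    by simp
  have d3: "((\<lambda>p. 1 / lapse (G p)) has_derivative (\<lambda>w. inner (G p) (B w) / s ^ 3)) (at p)"
    using s by (auto intro!: derivative_eq_intros d2 simp: s_def fun_eq_iff power3_eq_cube)
  have dN: "frechet_derivative (future_unit_normal f) (at p) = (\<lambda>w. (hyp_hess (G p) (B w), inner (G p) (B w) / s ^ 3))"
    unfolding N by (rule frechet_derivative_at[symmetric]) (rule has_derivative_Pair[OF d1 d3])
  \<comment> \<open>The vertical part of the eigenvalue equation follows from the horizontal one, since the normal stays orthogonal to its own derivative.\<close>
  have third: "inner (G p) (B w) / s ^ 3 = k * inner (G p) w" if "hyp_hess (G p) (B w) = k *\<^sub>R w" for w k
  proof -
    have zz: "inner (G p) (G p) = 1 - s\<^sup>2" using lapse_square[OF a] by (simp add: s_def power2_norm_eq_inner)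
    have "k * inner (G p) w = inner (G p) (hyp_hess (G p) (B w))" by (simp add: that)
    also have "\<dots> = inner (G p) (B w) / s + inner (G p) (B w) / s ^ 3 * inner (G p) (G p)"
      by (simp add: hyp_hess_def inner_add_right flip: s_def)
    also have "\<dots> = inner (G p) (B w) / s ^ 3"
      using s unfolding zz by (simp add: field_simps power2_eq_square power3_eq_cube)
    finally show ?thesis by simp
  qed
  have eigen: "shape_operator f p (w, inner (G p) w) = k *\<^sub>R (w, inner (G p) w) \<longleftrightarrow>
      hyp_hess (G p) (B w) = k *\<^sub>R w" for k w
    using third[of w k] by (auto simp: shape_operator_def dN)
  have nz: "(w, inner (G p) w) \<noteq> 0 \<longleftrightarrow> w \<noteq> 0" for w
    by (auto simp: zero_prod_def)
  have "(\<exists>v\<in>tangent_plane f p. v \<noteq> 0 \<and> shape_operator f p v = k *\<^sub>R v) \<longleftrightarrow>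
      (\<exists>w. w \<noteq> 0 \<and> hyp_hess (G p) (B w) = k *\<^sub>R w)" for k
    unfolding tangent_plane_def fd bex_simps eigen nz by (rule refl)
  then show ?thesis by (simp add: principal_curvatures_def)
qed

section \<open>Symmetric operators and Hessians\<close>

text \<open>The quotient of the two forms attains a minimum \<open>m\<close> on the unit sphere. There \<open>B - m P\<close> is positive semidefinite with a
null vector of its form, and such a vector lies in the kernel; so \<open>m\<close> is an eigenvalue, and \<open>c \<le> m\<close>.\<close>

lemma smallest_generalized_eigenvalue:
  fixes B P :: "'a::euclidean_space \<Rightarrow> 'a"
  assumes B: "linear B" "\<And>v w. inner v (B w) = inner (B v) w"
    and P: "linear P" "\<And>v w. inner v (P w) = inner (P v) w" "\<And>w. w \<noteq> 0 \<Longrightarrow> 0 < inner w (P w)"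
    and c: "\<And>k w. w \<noteq> 0 \<Longrightarrow> B w = k *\<^sub>R P w \<Longrightarrow> c \<le> k"
  shows "c * inner w (P w) \<le> inner w (B w)"
proof -
  have bl: "bounded_linear B" "bounded_linear P" using B(1) P(1) linear_conv_bounded_linear by blast+
  let ?q = "\<lambda>w. inner w (B w) / inner w (P w)"
  have ne: "inner w (P w) \<noteq> 0" if "w \<in> sphere 0 1" for w
    using P(3)[of w] that by force
  have cont: "continuous_on (sphere 0 1) ?q"
    using ne by (intro continuous_intros linear_continuous_on bl)
       (auto intro: linear_continuous_on bl)
  obtain b :: 'a where "b \<in> Basis" using nonempty_Basis by blast
  then have "b \<in> sphere 0 1" by simp
  then have "sphere (0::'a) 1 \<noteq> {}" by blast
  then obtain w0 where w0: "w0 \<in> sphere 0 1" "\<And>w. w \<in> sphere 0 1 \<Longrightarrow> ?q w0 \<le> ?q w"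
    using continuous_attains_inf[OF compact_sphere _ cont] by blast
  define m where "m = ?q w0"
  define Q where "Q = (\<lambda>w. B w - m *\<^sub>R P w)"
  have linQ: "linear Q" unfolding Q_def
    using B(1) P(1) by (auto intro!: linear_compose_sub linear_compose_scale_right)
  have symQ: "inner v (Q w) = inner (Q v) w" for v w
    by (simp add: Q_def inner_diff_left inner_diff_right B(2) P(2))
  have psd: "0 \<le> inner w (Q w)" for w
  proof (cases "w = 0")
    case False
    define e where "e = (1 / norm w) *\<^sub>R w"
    have e: "e \<in> sphere 0 1" "w = norm w *\<^sub>R e" using False by (auto simp: e_def)
    have "0 < inner e (P e)" using P(3)[of e] e by force
    with w0(2)[OF e(1)] have "m * inner e (P e) \<le> inner e (B e)" by (simp add: m_def field_simps)
    then have "0 \<le> inner e (Q e)" by (simp add: Q_def inner_diff_right)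
    moreover have "Q w = norm w *\<^sub>R Q e" by (metis e(2) linear_scale[OF linQ])
    then have "inner w (Q w) = inner (norm w *\<^sub>R e) (norm w *\<^sub>R Q e)" using e(2) by metis
    then have "inner w (Q w) = (norm w)\<^sup>2 * inner e (Q e)" by (simp add: power2_eq_square)
    ultimately show ?thesis by simp
  qed simp
  have null: "inner w0 (Q w0) = 0" using ne[OF w0(1)] by (simp add: Q_def m_def inner_diff_right)
  have "Q w0 = 0"
  proof (rule ccontr)
    assume "Q w0 \<noteq> 0"
    define y where "y = Q w0"
    define a where "a = inner y (Q y)"
    have y: "0 < (norm y)\<^sup>2" using \<open>Q w0 \<noteq> 0\<close> by (simp add: y_def)
    have a: "0 \<le> a" using psd by (simp add: a_def)
    have "0 \<le> inner (w0 - t *\<^sub>R y) (Q (w0 - t *\<^sub>R y))" for t by (rule psd)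
    moreover have "inner (w0 - t *\<^sub>R y) (Q (w0 - t *\<^sub>R y)) = - 2 * t * (norm y)\<^sup>2 + t\<^sup>2 * a" for t
      using null symQ[of w0 y]
      by (simp add: linear_diff[OF linQ] linear_scale[OF linQ] inner_diff_left inner_diff_right a_def
          dot_square_norm power2_eq_square algebra_simps flip: y_def)
    ultimately have t: "0 \<le> - 2 * t * (norm y)\<^sup>2 + t\<^sup>2 * a" for t by metis
    \<comment> \<open>A small step from \<open>w0\<close> against \<open>y\<close> would make the form negative.\<close>
    define t where "t = (norm y)\<^sup>2 / (a + 1)"
    have "t > 0" using y a by (simp add: t_def)
    have "0 \<le> t * (- 2 * (norm y)\<^sup>2 + t * a)" using t[of t] by (simp add: power2_eq_square algebra_simps)
    then have "2 * (norm y)\<^sup>2 \<le> t * a" using \<open>t > 0\<close> by (simp add: zero_le_mult_iff)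
    moreover have "t * a \<le> (norm y)\<^sup>2" using a y by (simp add: t_def field_simps)
    ultimately show False using y by simp
  qed
  then have "B w0 = m *\<^sub>R P w0" by (simp add: Q_def)
  moreover have "w0 \<noteq> 0" using w0(1) by auto
  ultimately have "c \<le> m" by (rule c[rotated])
  have "0 \<le> inner w (P w)" using P(3)[of w] by (cases "w = 0") auto
  then have "c * inner w (P w) \<le> m * inner w (P w)" using \<open>c \<le> m\<close> by (rule mult_right_mono[rotated])
  also have "\<dots> \<le> inner w (B w)" using psd[of w] by (simp add: Q_def inner_diff_right)
  finally show ?thesis .
qed

text \<open>Passing to inverses reverses the order of positive forms: if \<open>B\<close> is at least \<open>c P\<close>, then the inverse of \<open>B\<close> is at most
\<open>1 / c\<close> times the inverse \<open>H\<close> of \<open>P\<close>. The proof expands the \<open>P\<close>-square of \<open>v - H w / c\<close>.\<close>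

lemma inverse_form_le:
  fixes P B H :: "'a::real_inner \<Rightarrow> 'a"
  assumes "linear P" and P: "\<And>v w. inner v (P w) = inner (P v) w" "\<And>w. 0 \<le> inner w (P w)"
    and "0 < c" and B: "c * inner v (P v) \<le> inner v (B v)"
    and w: "B v = w" "P (H w) = w"
  shows "inner v w \<le> (1 / c) * inner w (H w)"
proof -
  define y where "y = H w"
  have "0 \<le> inner (v - (1 / c) *\<^sub>R y) (P (v - (1 / c) *\<^sub>R y))" by (rule P)
  also have "\<dots> = inner v (P v) - 2 / c * inner v w + (1 / c)\<^sup>2 * inner y w"
    using P(1)[of y v] w
    by (simp add: linear_diff[OF \<open>linear P\<close>] linear_scale[OF \<open>linear P\<close>] inner_diff_left inner_diff_right
       power2_eq_square algebra_simps inner_commute flip: y_def)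
  finally have "0 \<le> c * (inner v (P v) - 2 / c * inner v w + (1 / c)\<^sup>2 * inner y w)"
    using \<open>0 < c\<close> by simp
  also have "\<dots> = c * inner v (P v) - 2 * inner v w + (1 / c) * inner y w"
    using \<open>0 < c\<close> by (simp add: algebra_simps power2_eq_square)
  finally show ?thesis using B w by (simp add: y_def inner_commute)
qed

text \<open>The mixed second difference of \<open>f\<close> at \<open>p\<close> is symmetric in its two increments. The mean value theorem for the difference of
\<open>f\<close> along two parallel segments, combined with differentiability of the gradient at the single point \<open>p\<close>, identifies
its leading term.\<close>

lemma hessian_symmetric:
  fixes f :: "'a::real_inner \<Rightarrow> real"
  assumes G: "\<And>p. (f has_derivative inner (G p)) (at p)" and B: "(G has_derivative B) (at p)"
  shows "inner (B v) w = inner v (B w)"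
proof -
  interpret bounded_linear B using B by (rule has_derivative_bounded_linear)
  have key: "\<exists>d>0. \<forall>t. 0 < t \<and> t < d \<longrightarrow>
      \<bar>f (p + t *\<^sub>R v + t *\<^sub>R w) - f (p + t *\<^sub>R v) - f (p + t *\<^sub>R w) + f p - t\<^sup>2 * inner (B v) w\<bar> \<le> e * t\<^sup>2"
    if "e > 0" for e v w
  proof -
    define M where "M = 2 * (norm v + norm w + 1) * (norm w + 1)"
    have M: "M > 0" unfolding M_def by (intro mult_pos_pos) (smt (verit) norm_ge_zero)+
    obtain d where d: "d > 0" "\<And>y. norm y < d \<Longrightarrow> norm (G (p + y) - G p - B y) \<le> (e / M) * norm y"
    proof -
      have "e / M > 0" using M \<open>e > 0\<close> by simp
      then obtain d where "d > 0" "\<And>x. norm (x - p) < d \<Longrightarrow> norm (G x - G p - B (x - p)) \<le> (e / M) * norm (x - p)"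
        using B unfolding has_derivative_at_alt by meson
      then show ?thesis using that[of d] by (metis add_diff_cancel_left')
    qed
    define d' where "d' = d / (norm v + norm w + 1)"
    have "d' > 0" unfolding d'_def using d by (intro divide_pos_pos) (smt (verit) norm_ge_zero)+
    moreover have "\<bar>f (p + t *\<^sub>R v + t *\<^sub>R w) - f (p + t *\<^sub>R v) - f (p + t *\<^sub>R w) + f p - t\<^sup>2 * inner (B v) w\<bar> \<le> e * t\<^sup>2"
      if t: "0 < t" "t < d'" for t
    proof -
      let ?psi = "\<lambda>s. f ((p + t *\<^sub>R v) + s *\<^sub>R ((p + t *\<^sub>R v + t *\<^sub>R w) - (p + t *\<^sub>R v)))
             - f (p + s *\<^sub>R ((p + t *\<^sub>R w) - p))"
      let ?psi' = "\<lambda>s. inner (G (p + t *\<^sub>R v + s *\<^sub>R (t *\<^sub>R w)) - G (p + s *\<^sub>R (t *\<^sub>R w))) (t *\<^sub>R w)"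
      have "\<exists>z>0. z < 1 \<and> ?psi 1 - ?psi 0 = (1 - 0) * ?psi' z"
      proof (rule MVT2)
        fix s :: real
        show "(?psi has_real_derivative ?psi' s) (at s)"
          using DERIV_diff[OF
              function_DERIV_along_line[OF G, where x = "p + t *\<^sub>R v" and t = s and y = "p + t *\<^sub>R v + t *\<^sub>R w"]
              function_DERIV_along_line[OF G, where x = p and t = s and y = "p + t *\<^sub>R w"]]
          by (simp add: inner_diff_left right_diff_distrib)
      qed simp
      then obtain s where s: "0 < s" "s < 1" "?psi 1 - ?psi 0 = ?psi' s" by auto
      define y1 where "y1 = t *\<^sub>R v + s *\<^sub>R (t *\<^sub>R w)"
      define y2 where "y2 = s *\<^sub>R (t *\<^sub>R w)"
      have n2: "norm y2 \<le> t * norm w" using s t by (simp add: y2_def mult_left_le_one_le)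
      have n1: "norm y1 \<le> t * norm v + norm y2"
        using norm_triangle_ineq[of "t *\<^sub>R v" y2] t by (simp add: y1_def y2_def)
      have ts: "t * (norm v + norm w + 1) < d" using t unfolding d'_def
        by (simp add: pos_less_divide_eq add_nonneg_pos)
      have n1': "norm y1 \<le> t * (norm v + norm w + 1)" and n2': "norm y2 \<le> t * (norm v + norm w + 1)"
        using n1 n2 t by (auto simp: algebra_simps) (smt (verit) mult_nonneg_nonneg norm_ge_zero)
      let ?R = "(G (p + y1) - G p - B y1) - (G (p + y2) - G p - B y2)"
      have "norm ?R \<le> norm (G (p + y1) - G p - B y1) + norm (G (p + y2) - G p - B y2)"
        by (rule norm_triangle_ineq4)
      also have "\<dots> \<le> (e / M) * norm y1 + (e / M) * norm y2"
        using n1' n2' ts by (intro add_mono d) auto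
      also have "\<dots> \<le> (e / M) * (t * (norm v + norm w + 1)) + (e / M) * (t * (norm v + norm w + 1))"
        using n1' n2' M \<open>e > 0\<close> by (intro add_mono mult_left_mono) auto
      finally have R: "norm ?R \<le> 2 * (e / M) * (t * (norm v + norm w + 1))" by simp
      have "y1 - y2 = t *\<^sub>R v" by (simp add: y1_def y2_def)
      then have "B y1 - B y2 = t *\<^sub>R B v" by (metis diff scaleR)
      then have eq: "G (p + y1) - G (p + y2) - t *\<^sub>R B v = ?R" by (simp add: algebra_simps)
      have "f (p + t *\<^sub>R v + t *\<^sub>R w) - f (p + t *\<^sub>R v) - f (p + t *\<^sub>R w) + f p = ?psi 1 - ?psi 0" by simp
      also have "\<dots> = t * inner (G (p + y1) - G (p + y2)) w" using s by (simp add: y1_def y2_def add.assoc)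
      finally have "f (p + t *\<^sub>R v + t *\<^sub>R w) - f (p + t *\<^sub>R v) - f (p + t *\<^sub>R w) + f p - t\<^sup>2 * inner (B v) w
         = t * inner (G (p + y1) - G (p + y2) - t *\<^sub>R B v) w"
        by (simp add: inner_diff_left power2_eq_square algebra_simps)
      also have "\<dots> = t * inner ?R w" unfolding eq ..
      finally have "\<bar>f (p + t *\<^sub>R v + t *\<^sub>R w) - f (p + t *\<^sub>R v) - f (p + t *\<^sub>R w) + f p - t\<^sup>2 * inner (B v) w\<bar> = t * \<bar>inner ?R w\<bar>"
        using t by (simp only: abs_mult)
      also have "\<dots> \<le> t * (norm ?R * norm w)"
        using t by (intro mult_left_mono Cauchy_Schwarz_ineq2) auto
      also have "\<dots> \<le> t * ((2 * (e / M) * (t * (norm v + norm w + 1))) * (norm w + 1))"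
        using t M \<open>e > 0\<close> by (intro mult_left_mono mult_mono R) auto
      also have "\<dots> = t\<^sup>2 * ((e / M) * M)"
        unfolding M_def power2_eq_square by (simp only: ac_simps)
      also have "\<dots> = e * t\<^sup>2" using M by simp
      finally show ?thesis .
    qed
    ultimately show ?thesis by blast
  qed
  have "\<bar>inner (B v) w - inner (B w) v\<bar> \<le> e" if "e > 0" for e
  proof -
    obtain d1 where d1: "d1 > 0" "\<And>t. 0 < t \<Longrightarrow> t < d1 \<Longrightarrow> \<bar>f (p + t *\<^sub>R v + t *\<^sub>R w) - f (p + t *\<^sub>R v) - f (p + t *\<^sub>R w) + f p - t\<^sup>2 * inner (B v) w\<bar> \<le> e / 2 * t\<^sup>2"
      using key[of "e / 2" v w] \<open>e > 0\<close> by auto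
    obtain d2 where d2: "d2 > 0" "\<And>t. 0 < t \<Longrightarrow> t < d2 \<Longrightarrow> \<bar>f (p + t *\<^sub>R w + t *\<^sub>R v) - f (p + t *\<^sub>R w) - f (p + t *\<^sub>R v) + f p - t\<^sup>2 * inner (B w) v\<bar> \<le> e / 2 * t\<^sup>2"
      using key[of "e / 2" w v] \<open>e > 0\<close> by auto
    define t where "t = min d1 d2 / 2"
    have t: "0 < t" "t < d1" "t < d2" using d1 d2 by (auto simp: t_def)
    define X where "X = f (p + t *\<^sub>R v + t *\<^sub>R w) - f (p + t *\<^sub>R v) - f (p + t *\<^sub>R w) + f p"
    have swap: "f (p + t *\<^sub>R w + t *\<^sub>R v) - f (p + t *\<^sub>R w) - f (p + t *\<^sub>R v) + f p = X"
      by (simp add: X_def add.assoc add.commute[of "t *\<^sub>R w"])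
    have "\<bar>X - t\<^sup>2 * inner (B v) w\<bar> \<le> e / 2 * t\<^sup>2" "\<bar>X - t\<^sup>2 * inner (B w) v\<bar> \<le> e / 2 * t\<^sup>2"
      using d1(2)[OF t(1,2)] d2(2)[OF t(1,3)] by (simp_all only: swap X_def)
    moreover have "\<bar>a - b\<bar> \<le> 2 * q" if "\<bar>X - a\<bar> \<le> q" "\<bar>X - b\<bar> \<le> q" for a b q :: real
      using that by linarith
    ultimately have "\<bar>t\<^sup>2 * inner (B v) w - t\<^sup>2 * inner (B w) v\<bar> \<le> 2 * (e / 2 * t\<^sup>2)" by blast
    then have "\<bar>t\<^sup>2 * inner (B v) w - t\<^sup>2 * inner (B w) v\<bar> \<le> e * t\<^sup>2" by simp
    moreover have "\<bar>t\<^sup>2 * inner (B v) w - t\<^sup>2 * inner (B w) v\<bar> = t\<^sup>2 * \<bar>inner (B v) w - inner (B w) v\<bar>"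
      by (simp add: abs_mult flip: right_diff_distrib)
    ultimately have "t\<^sup>2 * \<bar>inner (B v) w - inner (B w) v\<bar> \<le> t\<^sup>2 * e" by (simp add: mult.commute)
    then show ?thesis using t by simp
  qed
  then have "\<bar>inner (B v) w - inner (B w) v\<bar> \<le> 0" by (meson field_le_epsilon add_0 le_less_linear dense_ge)
  then show ?thesis by (simp add: inner_commute)
qed

section \<open>From the curvature bound to the Zygmund condition\<close>

lemma mink_entire_graph: "mink (p, t) (z, 1) = inner p z - t"
  by (simp add: mink_eq_inner)

text \<open>Finiteness of the support function on a whole neighbourhood of \<open>z\<close> makes \<open>q \<mapsto> z \<bullet> q - f q\<close> coercive: tilting \<open>z\<close> by \<open>\<delta>\<close>
in the direction of \<open>q\<close> adds \<open>\<delta> |q|\<close> and keeps the value bounded. So the supremum is attained.\<close>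

lemma support_function_maximizer:
  assumes f: "continuous_on UNIV f" and u: "continuous_on (ball 0 1) u"
    and sup: "\<And>z. z \<in> ball 0 1 \<Longrightarrow> support_function (entire_graph f) z = ereal (u z)"
    and z: "z \<in> ball 0 1"
  obtains p where "\<And>q. inner z q - f q \<le> inner z p - f p" "u z = inner z p - f p"
proof -
  have le: "inner p y - f p \<le> u y" if "y \<in> ball 0 1" for p y
  proof -
    have "ereal (mink (p, f p) (y, 1)) \<le> support_function (entire_graph f) y"
      unfolding support_function_def by (rule SUP_upper) (auto simp: entire_graph_def)
    then show ?thesis using sup[OF that] by (simp add: mink_entire_graph)
  qed
  obtain \<delta> where \<delta>: "\<delta> > 0" "cball z \<delta> \<subseteq> ball 0 1"
    using z open_contains_cball[of "ball (0::complex) 1"] open_ball by blast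
  have "compact (u ` cball z \<delta>)"
    using \<delta> u by (intro compact_continuous_image continuous_on_subset[OF u]) auto
  then obtain M where "\<forall>x\<in>u ` cball z \<delta>. norm x \<le> M"
    using compact_imp_bounded bounded_iff by metis
  then have M: "u y \<le> M" if "y \<in> cball z \<delta>" for y
    using that by (auto simp: abs_le_iff)
  have coercive: "norm p * \<delta> + inner p z - f p \<le> M" for p
  proof (cases "p = 0")
    case True
    then show ?thesis using le[of z 0] z M[of z] \<delta> by simp
  next
    case False
    define y where "y = z + (\<delta> / norm p) *\<^sub>R p"
    have y: "y \<in> cball z \<delta>" using False \<delta> by (simp add: y_def dist_norm)
    have "inner p y = norm p * \<delta> + inner p z"
      using False by (simp add: y_def inner_add_right dot_square_norm power2_eq_square)
    then show ?thesis using le[of y p] M[OF y] y \<delta> by auto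
  qed
  define R where "R = max 0 ((M + f 0) / \<delta>)"
  have "continuous_on (cball 0 R) (\<lambda>p. inner z p - f p)"
    by (intro continuous_intros continuous_on_subset[OF f]) auto
  moreover have "cball (0::complex) R \<noteq> {}" by (simp add: R_def)
  ultimately obtain p where p: "p \<in> cball 0 R" "\<And>q. q \<in> cball 0 R \<Longrightarrow> inner z q - f q \<le> inner z p - f p"
    using continuous_attains_sup[OF compact_cball] by blast
  have max: "inner z q - f q \<le> inner z p - f p" for q
  proof (cases "norm q \<le> R")
    case False
    then have "(M + f 0) / \<delta> < norm q" by (simp add: R_def)
    then have "M + f 0 < norm q * \<delta>" using \<delta> by (simp add: field_simps)
    then have "inner z q - f q \<le> inner z 0 - f 0" using coercive[of q] by (simp add: inner_commute)
    also have "\<dots> \<le> inner z p - f p" using p(2)[of 0] by (simp add: R_def)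
    finally show ?thesis .
  qed (simp add: p)
  have "support_function (entire_graph f) z \<le> ereal (inner z p - f p)"
    unfolding support_function_def
    by (rule SUP_least) (use max in \<open>auto simp: entire_graph_def mink_entire_graph inner_commute\<close>)
  then have "u z = inner z p - f p" using sup[OF z] le[OF z, of p] by (simp add: inner_commute)
  with max show ?thesis by (rule that)
qed

text \<open>The curvature bound says that the Hessian \<open>B\<close> of \<open>f\<close> is at least \<open>c\<close> times \<open>hyp_metric\<close>. The gradient of \<open>f\<close> is then
injective, and onto the disc because each value of the support function is attained. The Hessian of the support function is
the inverse of \<open>B\<close>, hence at most \<open>1 / c\<close> times \<open>hyp_hess\<close>.\<close>

lemma support_function_pinched:
  assumes G: "\<And>p. (f has_derivative inner (G p)) (at p)" and small: "\<And>p. norm (G p) < 1"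
    and B: "\<And>p. (G has_derivative B p) (at p)"
    and c: "0 < c" "\<And>p k. k \<in> principal_curvatures f p \<Longrightarrow> c \<le> k"
    and u: "convex_on (ball 0 1) u"
    and sup: "\<And>z. z \<in> ball 0 1 \<Longrightarrow> support_function (entire_graph f) z = ereal (u z)"
  shows "convex_on (ball 0 1) (\<lambda>z. (1 / c) * (- lapse z) - u z)"
proof -
  have linB: "linear (B p)" for p using B[of p] by (simp add: bounded_linear.linear has_derivative_bounded_linear)
  have Bge: "c * inner w (hyp_metric (G p) w) \<le> inner w (B p w)" for p w
  proof (rule smallest_generalized_eigenvalue[OF linB _ linear_hyp_metric])
    show "inner v (B p w) = inner (B p v) w" for v w
      using hessian_symmetric[OF G B] by metis
    fix k w assume w: "w \<noteq> 0" "B p w = k *\<^sub>R hyp_metric (G p) w"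
    then have "hyp_hess (G p) (B p w) = k *\<^sub>R w"
      by (simp add: linear_scale[OF linear_hyp_hess] hyp_metric_inverse[OF small])
    then show "c \<le> k" using w c(2) principal_curvatures_eq[OF G small B] by blast
  qed (use hyp_metric_symmetric hyp_metric_pos[OF small] in blast)+
  have Bpos: "0 < inner w (B p w)" if "w \<noteq> 0" for p w
    using Bge[of w p] hyp_metric_pos[OF small that, of p] c(1) by (meson less_le_trans mult_pos_pos)
  have "inj G"
  proof (rule injI, rule ccontr)
    fix x y assume "G x = G y" "x \<noteq> y"
    then show False using gradient_strictly_monotone[of UNIV G B x y] B Bpos by simp
  qed
  define Z where "Z = inv G"
  have ZG: "Z (G p) = p" for p using \<open>inj G\<close> by (simp add: Z_def)
  have contf: "continuous_on UNIV f"
    using G by (meson continuous_at_imp_continuous_on has_derivative_continuous)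
  have contu: "continuous_on (ball 0 1) u"
    using u by (intro convex_on_continuous) auto
  have Z: "G (Z z) = z" "u z = inner z (Z z) - f (Z z)" if z: "z \<in> ball 0 1" for z
  proof -
    obtain p where p: "\<And>q. inner z q - f q \<le> inner z p - f p" "u z = inner z p - f p"
      using support_function_maximizer[OF contf contu sup z] by metis
    have "G p = z" by (rule gradient_at_interior_maximum[of UNIV p f]) (use G p in auto)
    then show "G (Z z) = z" "u z = inner z (Z z) - f (Z z)" using p ZG by auto
  qed
  have dZ: "(Z has_derivative inv (B (Z z))) (at z)" and
    du': "((\<lambda>z. inner z (Z z) - f (Z z)) has_derivative inner (Z z)) (at z)" if z: "z \<in> ball 0 1" for z
    using legendre_derivatives[of UNIV "Z z" f G B Z] G[of "Z z"] B Bpos ZG Z(1)[OF z] by auto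
  have du: "(u has_derivative inner (Z z)) (at z)" if z: "z \<in> ball 0 1" for z
    by (rule has_derivative_transform_within_open[OF du'[OF z] open_ball z]) (simp add: Z)
  let ?U = "\<lambda>z. (1 / c) * (- lapse z) - u z"
  let ?g = "\<lambda>z. (1 / c) *\<^sub>R ((1 / lapse z) *\<^sub>R z) - Z z"
  let ?H = "\<lambda>z w. (1 / c) *\<^sub>R hyp_hess z w - inv (B (Z z)) w"
  have dU: "(?U has_derivative inner (?g z)) (at z)" if z: "z \<in> ball 0 1" for z
  proof -
    have "(?U has_derivative (\<lambda>w. (1 / c) * inner ((1 / lapse z) *\<^sub>R z) w - inner (Z z) w)) (at z)"
      using z by (intro has_derivative_diff has_derivative_mult_right lapse_has_derivative du) auto
    then show ?thesis by (simp add: inner_diff_left[abs_def])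
  qed
  have dg: "(?g has_derivative ?H z) (at z)" if z: "z \<in> ball 0 1" for z
    using z by (intro has_derivative_diff has_derivative_scaleR_right hyp_hess_has_derivative dZ) auto
  have pos: "0 \<le> inner w (?H z w)" if z: "z \<in> ball 0 1" for z w
  proof -
    note inv = positive_definite_inverse[OF linB Bpos]
    have "inner (inv (B (Z z)) w) w \<le> (1 / c) * inner w (hyp_hess z w)"
    proof (rule inverse_form_le[where P = "hyp_metric z" and B = "B (Z z)"])
      show "c * inner (inv (B (Z z)) w) (hyp_metric z (inv (B (Z z)) w)) \<le>
          inner (inv (B (Z z)) w) (B (Z z) (inv (B (Z z)) w))"
        using Bge[of _ "Z z"] by (simp only: Z(1)[OF z])
      show "inner v (hyp_metric z w) = inner (hyp_metric z v) w" for v w by (rule hyp_metric_symmetric)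
      show "0 \<le> inner w (hyp_metric z w)" for w
        using hyp_metric_pos[of z w] z by (cases "w = 0") auto
    qed (use c z in \<open>auto simp: linear_hyp_metric inv hyp_metric_inverse\<close>)
    then show ?thesis by (simp add: inner_diff_right inner_commute)
  qed
  show ?thesis
  proof (rule convex_on_if_subgradients[of _ _ ?g])
    show "?U x + inner (?g x) (y - x) \<le> ?U y" if "x \<in> ball 0 1" "y \<in> ball 0 1" for x y
      using subgradient_inequality[where u = ?U and g = ?g and A = ?H, OF convex_ball dU dg pos that] .
  qed (rule convex_ball)
qed

text \<open>Convexity extends to segments with endpoints on the boundary, where only an upper bound for the lower limit is known:
interior points nearly realising the bounds at both ends give interior segments, and a convex function is continuous in
the interior.\<close>

lemma convex_le_boundary_values:
  fixes k :: "'a::euclidean_space \<Rightarrow> real"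
  assumes k: "convex_on S k" "open S"
    and a: "\<And>e d. e > 0 \<Longrightarrow> d > 0 \<Longrightarrow> \<exists>z\<in>S. dist z a < d \<and> k z < A + e"
    and b: "\<And>e d. e > 0 \<Longrightarrow> d > 0 \<Longrightarrow> \<exists>z\<in>S. dist z b < d \<and> k z < B + e"
    and t: "0 \<le> t" "t \<le> 1" and m: "(1 - t) *\<^sub>R a + t *\<^sub>R b \<in> S"
  shows "k ((1 - t) *\<^sub>R a + t *\<^sub>R b) \<le> (1 - t) * A + t * B"
proof -
  have "convex S" using k by (simp add: convex_on_def)
  define d where "d n = inverse (real (Suc n))" for n
  have d: "d n > 0" for n by (simp add: d_def)
  have d0: "d \<longlonglongrightarrow> 0" unfolding d_def by (rule LIMSEQ_inverse_real_of_nat)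
  obtain x where x: "\<And>n. x n \<in> S" "\<And>n. dist (x n) a < d n" "\<And>n. k (x n) < A + d n"
  proof -
    have "\<forall>n. \<exists>z. z \<in> S \<and> dist z a < d n \<and> k z < A + d n" using a[OF d d] by blast
    then show ?thesis using that unfolding choice_iff by blast
  qed
  obtain y where y: "\<And>n. y n \<in> S" "\<And>n. dist (y n) b < d n" "\<And>n. k (y n) < B + d n"
  proof -
    have "\<forall>n. \<exists>z. z \<in> S \<and> dist z b < d n \<and> k z < B + d n" using b[OF d d] by blast
    then show ?thesis using that unfolding choice_iff by blast
  qed
  have lx: "x \<longlonglongrightarrow> a" and ly: "y \<longlonglongrightarrow> b"
    using x(2) y(2) d0 by (auto intro!: metric_tendsto_imp_tendsto[OF d0] always_eventually simp: less_imp_le d less_le_trans abs_of_pos)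
  have "(\<lambda>n. k ((1 - t) *\<^sub>R x n + t *\<^sub>R y n)) \<longlonglongrightarrow> k ((1 - t) *\<^sub>R a + t *\<^sub>R b)"
  proof (rule isCont_tendsto_compose[where g = k])
    show "isCont k ((1 - t) *\<^sub>R a + t *\<^sub>R b)"
      using convex_on_continuous[OF k(2,1)] m k(2) by (simp add: continuous_on_eq_continuous_at)
  qed (intro tendsto_intros lx ly)
  moreover have "(\<lambda>n. (1 - t) * (A + d n) + t * (B + d n)) \<longlonglongrightarrow> (1 - t) * (A + 0) + t * (B + 0)"
    by (intro tendsto_intros d0)
  moreover have "k ((1 - t) *\<^sub>R x n + t *\<^sub>R y n) \<le> (1 - t) * (A + d n) + t * (B + d n)" for n
  proof -
    have "k ((1 - t) *\<^sub>R x n + t *\<^sub>R y n) \<le> (1 - t) * k (x n) + t * k (y n)"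
      using convex_onD[OF k(1) t x(1) y(1)] .
    also have "\<dots> \<le> (1 - t) * (A + d n) + t * (B + d n)"
      using t x(3)[of n] y(3)[of n] by (intro add_mono mult_left_mono) auto
    finally show ?thesis .
  qed
  ultimately show ?thesis using LIMSEQ_le by fastforce
qed

lemma cis_chord_midpoint: "(1 - 1/2) *\<^sub>R cis (\<theta> + h) + (1/2) *\<^sub>R cis (\<theta> - h) = cos h *\<^sub>R cis \<theta>"
  by (simp add: complex_eq_iff cos_add cos_diff sin_add sin_diff algebra_simps)

text \<open>The point \<open>m = cos h cis \<theta>\<close> is the midpoint of a chord and a point of a radius. Each of the two convex functions
is bounded above at \<open>m\<close> along each of the two segments; these four bounds enclose the second difference
of \<open>\<phi>\<close> within \<open>O(|h|)\<close>. For \<open>cos h < 0\<close> the step is at least \<open>1\<close> and boundedness of \<open>\<phi>\<close> suffices.\<close>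

lemma zygmund_if_pinched:
  assumes \<phi>: "continuous_on (sphere 0 1) \<phi>" and K: "0 \<le> K"
    and u: "convex_on (ball 0 1) u" and v: "convex_on (ball 0 1) (\<lambda>z. K * (- lapse z) - u z)"
    and lim: "\<And>z0. z0 \<in> sphere 0 1 \<Longrightarrow> ereal (\<phi> z0) = Liminf (at z0 within ball 0 1) (\<lambda>z. ereal (u z))"
  shows "zygmund \<phi>"
proof -
  let ?v = "\<lambda>z. K * (- lapse z) - u z"
  have bu: "\<exists>z\<in>ball 0 1. dist z z0 < d \<and> u z < \<phi> z0 + e" if "z0 \<in> sphere 0 1" "e > 0" "d > 0" for z0 e d
  proof (rule ccontr)
    assume "\<not> ?thesis"
    then have "\<forall>\<^sub>F z in at z0 within ball 0 1. ereal (\<phi> z0 + e) \<le> ereal (u z)"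
      using \<open>d > 0\<close> unfolding eventually_at by (intro exI[of _ d]) auto
    then have "ereal (\<phi> z0 + e) \<le> ereal (\<phi> z0)" unfolding lim[OF that(1)] by (rule Liminf_bounded)
    then show False using \<open>e > 0\<close> by simp
  qed
  have bv: "\<exists>z\<in>ball 0 1. dist z z0 < d \<and> ?v z < - \<phi> z0 + e" if z0: "z0 \<in> sphere 0 1" "e > 0" "d > 0" for z0 e d
  proof -
    have "\<forall>y < ereal (\<phi> z0). \<forall>\<^sub>F z in at z0 within ball 0 1. y < ereal (u z)"
      using lim[OF z0(1)] le_Liminf_iff by (metis order_refl)
    then have "\<forall>\<^sub>F z in at z0 within ball 0 1. ereal (\<phi> z0 - e) < ereal (u z)"
      using \<open>e > 0\<close> by (auto elim!: allE[of _ "ereal (\<phi> z0 - e)"])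
    moreover have "\<forall>\<^sub>F z in at z0 within ball 0 1. dist z z0 < d"
      unfolding eventually_at using \<open>d > 0\<close> by blast
    moreover have "\<forall>\<^sub>F z in at z0 within ball 0 1. z \<in> ball 0 1"
      by (auto simp: eventually_at_filter)
    ultimately have "\<forall>\<^sub>F z in at z0 within ball 0 1. z \<in> ball 0 1 \<and> dist z z0 < d \<and> \<phi> z0 - e < u z"
      by eventually_elim auto
    moreover have "z0 islimpt ball 0 1" using z0 by (simp add: islimpt_ball)
    then have "at z0 within ball 0 1 \<noteq> bot" by (simp add: trivial_limit_within)
    ultimately obtain z where z: "z \<in> ball 0 1" "dist z z0 < d" "\<phi> z0 - e < u z"
      using eventually_happens by blast
    have "0 \<le> K * lapse z" using K lapse_pos[of z] z by simp
    then show ?thesis using z by (intro bexI[of _ z]) auto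
  qed
  have centre: "\<exists>z\<in>ball 0 1. dist z 0 < d \<and> k z < k 0 + e" if "e > 0" "d > 0" for k :: "complex \<Rightarrow> real" and e d
    using that by (intro bexI[of _ 0]) auto
  obtain M where M: "\<And>z. z \<in> sphere 0 1 \<Longrightarrow> \<bar>\<phi> z\<bar> \<le> M"
  proof -
    have "bounded (\<phi> ` sphere 0 1)" using \<phi> by (intro compact_imp_bounded compact_continuous_image) auto
    then show ?thesis using that unfolding bounded_iff by (metis image_eqI real_norm_def)
  qed
  have M0: "0 \<le> M" using M[of 1] by simp
  define L where "L = K + \<bar>u 0\<bar> + M"
  have L0: "0 \<le> L" using K M0 by (simp add: L_def)
  have l0: "lapse 0 = 1" by (simp add: lapse_def)
  show ?thesis unfolding zygmund_def
  proof (intro exI[of _ "2 * K + 2 * L + 4 * M"] allI)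
    fix \<theta> h :: real
    let ?D = "\<bar>\<phi> (cis (\<theta> + h)) + \<phi> (cis (\<theta> - h)) - 2 * \<phi> (cis \<theta>)\<bar>"
    have b: "\<bar>\<phi> (cis t)\<bar> \<le> M" for t by (rule M) simp
    have hs: "\<bar>sin h\<bar> \<le> \<bar>h\<bar>" by (rule abs_sin_x_le_abs_x)
    have hc: "1 - cos h \<le> \<bar>h\<bar>"
    proof -
      have "1 - cos h = 2 * (sin (h/2))\<^sup>2" using cos_double_sin[of "h/2"] by simp
      also have "\<dots> \<le> 2 * \<bar>sin (h/2)\<bar>"
        using mult_left_mono[OF abs_sin_le_one[of "h/2"], of "\<bar>sin (h/2)\<bar>"]
        by (simp add: power2_eq_square)
      also have "\<dots> \<le> \<bar>h\<bar>" using abs_sin_x_le_abs_x[of "h/2"] by simp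
      finally show ?thesis .
    qed
    consider "cos h < 0" | "sin h = 0" "cos h = 1" | "0 \<le> cos h" "\<bar>cos h\<bar> < 1"
    proof -
      have "sin h = 0" if "cos h = 1" using sin_cos_squared_add[of h] that by simp
      then show ?thesis using that abs_cos_le_one[of h] by linarith
    qed
    then show "?D \<le> (2 * K + 2 * L + 4 * M) * \<bar>h\<bar>"
    proof cases
      case 1
      have "1 \<le> \<bar>h\<bar>" using hc 1 by linarith
      have "?D \<le> 4 * M" using b[of "\<theta> + h"] b[of "\<theta> - h"] b[of \<theta>] by linarith
      also have "\<dots> \<le> 4 * M * \<bar>h\<bar>" using \<open>1 \<le> \<bar>h\<bar>\<close> M0 mult_left_mono[of 1 "\<bar>h\<bar>" "4 * M"] by simp
      also have "\<dots> \<le> (2 * K + 2 * L + 4 * M) * \<bar>h\<bar>" using K L0 by (intro mult_right_mono) auto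
      finally show ?thesis .
    next
      case 2
      then have "cis h = 1" "cis (-h) = 1" by (auto simp: complex_eq_iff)
      then have "cis (\<theta> + h) = cis \<theta>" "cis (\<theta> - h) = cis \<theta>"
        by (metis cis_mult mult.right_neutral, metis cis_mult mult.right_neutral diff_conv_add_uminus)
      then show ?thesis using K L0 M0 by simp
    next
      case 3
      define r where "r = cos h"
      define m where "m = r *\<^sub>R cis \<theta>"
      have r: "0 \<le> r" "r < 1" using 3 by (auto simp: r_def)
      have m: "m \<in> ball 0 1" using r by (simp add: m_def)
      have lm: "lapse m = \<bar>sin h\<bar>"
        using r unfolding lapse_def m_def by (simp add: r_def real_sqrt_abs[symmetric] sin_squared_eq del: real_sqrt_abs)
      have chord: "k m \<le> (1 - 1/2) * A + (1/2) * B"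
        if "convex_on (ball 0 1) k"
          "\<And>e d. e > 0 \<Longrightarrow> d > 0 \<Longrightarrow> \<exists>z\<in>ball 0 1. dist z (cis (\<theta> + h)) < d \<and> k z < A + e"
          "\<And>e d. e > 0 \<Longrightarrow> d > 0 \<Longrightarrow> \<exists>z\<in>ball 0 1. dist z (cis (\<theta> - h)) < d \<and> k z < B + e" for k A B
        using convex_le_boundary_values[OF that(1) open_ball that(2,3), of "1/2"] m
        unfolding cis_chord_midpoint m_def r_def by simp
      have radius: "k m \<le> (1 - r) * k 0 + r * B"
        if "convex_on (ball 0 1) k"
          "\<And>e d. e > 0 \<Longrightarrow> d > 0 \<Longrightarrow> \<exists>z\<in>ball 0 1. dist z (cis \<theta>) < d \<and> k z < B + e" for k B
        using convex_le_boundary_values[OF that(1) open_ball centre that(2), of r] m r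
        by (simp add: m_def)
      have 1: "u m \<le> (1 - 1/2) * \<phi> (cis (\<theta> + h)) + 1/2 * \<phi> (cis (\<theta> - h))" by (rule chord[OF u]; rule bu) simp_all
      have 2: "?v m \<le> (1 - 1/2) * (- \<phi> (cis (\<theta> + h))) + 1/2 * (- \<phi> (cis (\<theta> - h)))" by (rule chord[OF v]; rule bv) simp_all
      have 3: "u m \<le> (1 - r) * u 0 + r * \<phi> (cis \<theta>)" by (rule radius[OF u]; rule bu) simp_all
      have 4: "?v m \<le> (1 - r) * ?v 0 + r * (- \<phi> (cis \<theta>))" by (rule radius[OF v]; rule bv) simp_all
      have X1: "(1 - r) * (u 0 - \<phi> (cis \<theta>)) \<le> (1 - r) * L" and X2: "(1 - r) * (- (K + u 0 - \<phi> (cis \<theta>))) \<le> (1 - r) * L"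
        using b[of \<theta>] K r by (auto intro!: mult_left_mono simp: L_def)
      have e1: "(1 - r) * u 0 + r * \<phi> (cis \<theta>) = (1 - r) * (u 0 - \<phi> (cis \<theta>)) + \<phi> (cis \<theta>)"
        and e2: "(1 - r) * ?v 0 + r * (- \<phi> (cis \<theta>)) = (1 - r) * (- (K + u 0 - \<phi> (cis \<theta>))) - \<phi> (cis \<theta>)"
        by (simp_all add: l0 algebra_simps)
      have e3: "?v m = - (K * \<bar>sin h\<bar>) - u m" by (simp add: lm)
      have combine: "\<bar>a + b - 2 * p\<bar> \<le> 2 * T + 2 * L'"
        if "2 * U \<le> a + b" "a + b \<le> 2 * T + 2 * U" "U \<le> X + p" "- T - U \<le> Y - p" "X \<le> L'" "Y \<le> L'"
        for U a b T X p Y L' :: real using that by linarith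
      have "2 * u m \<le> \<phi> (cis (\<theta> + h)) + \<phi> (cis (\<theta> - h))" using 1 by simp
      moreover have "\<phi> (cis (\<theta> + h)) + \<phi> (cis (\<theta> - h)) \<le> 2 * (K * \<bar>sin h\<bar>) + 2 * u m"
        using 2 unfolding e3 by simp
      ultimately have "?D \<le> 2 * (K * \<bar>sin h\<bar>) + 2 * ((1 - r) * L)"
        using 3[unfolded e1] 4[unfolded e2 e3] X1 X2 by (rule combine)
      also have "\<dots> \<le> 2 * (K * \<bar>h\<bar>) + 2 * (\<bar>h\<bar> * L)"
        using hs hc K L0 by (intro add_mono mult_left_mono mult_right_mono) (auto simp: r_def)
      also have "\<dots> \<le> (2 * K + 2 * L + 4 * M) * \<bar>h\<bar>" using M0 by (simp add: algebra_simps)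
      finally show ?thesis .
    qed
  qed
qed

lemma zygmund_if_curvature_bounded_below:
  assumes \<phi>: "continuous_on (sphere 0 1) \<phi>"
    and f: "spacelike_entire f" "C2 f" and c: "c > 0" "\<forall>p. \<forall>k\<in>principal_curvatures f p. c \<le> k"
    and u: "\<forall>z\<in>ball 0 1. support_function (entire_graph f) z = ereal (u z)" "extends_boundary u \<phi>"
  shows "zygmund \<phi>"
proof -
  obtain f' f'' where f': "\<And>p. (f has_derivative blinfun_apply (f' p)) (at p)"
    and f'': "\<And>p. (f' has_derivative blinfun_apply (f'' p)) (at p)"
    using f(2) unfolding C2_def C1_def by blast
  define G where "G p = (\<Sum>b\<in>Basis. blinfun_apply (f' p) b *\<^sub>R b)" for p
  have f'G: "blinfun_apply (f' p) = inner (G p)" for p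
  proof
    fix w
    have "blinfun_apply (f' p) w = blinfun_apply (f' p) (\<Sum>b\<in>Basis. inner w b *\<^sub>R b)" by (simp add: euclidean_representation)
    also have "\<dots> = inner (G p) w"
      by (simp add: G_def blinfun.sum_right blinfun.scaleR_right inner_sum_left mult.commute inner_commute[of w])
    finally show "blinfun_apply (f' p) w = inner (G p) w" .
  qed
  have G: "(f has_derivative inner (G p)) (at p)" for p using f'[of p] by (simp add: f'G)
  define B where "B p w = (\<Sum>b\<in>Basis. blinfun_apply (blinfun_apply (f'' p) w) b *\<^sub>R b)" for p w
  have B: "(G has_derivative B p) (at p)" for p
    unfolding G_def[abs_def] B_def[abs_def]
    by (auto intro!: derivative_eq_intros f'')
  have small: "norm (G p) < 1" for p
  proof -
    have fd: "frechet_derivative f (at p) = inner (G p)" using frechet_derivative_at[OF G] by simp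
    have "norm (inner (G p) (G p)) \<le> onorm (inner (G p)) * norm (G p)"
      by (rule onorm) (rule bounded_linear_inner_right)
    then have "norm (G p) * norm (G p) \<le> onorm (inner (G p)) * norm (G p)"
      by (simp add: power2_norm_eq_inner[symmetric] power2_eq_square)
    then have "norm (G p) \<le> onorm (inner (G p)) \<or> G p = 0" by auto
    then show ?thesis using f(1) unfolding spacelike_entire_def by (auto simp: fd dest!: spec[of _ p])
  qed
  have cu: "convex_on (ball 0 1) u" using u(2) by (simp add: extends_boundary_def)
  have "convex_on (ball 0 1) (\<lambda>z. (1 / c) * (- lapse z) - u z)"
    by (rule support_function_pinched[OF G small B]) (use c u cu in auto)
  moreover have "ereal (\<phi> z0) = Liminf (at z0 within ball 0 1) (\<lambda>z. ereal (u z))" if "z0 \<in> sphere 0 1" for z0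
    using u(2) that unfolding extends_boundary_def by blast
  moreover have "0 \<le> 1 / c" using c(1) by simp
  ultimately show ?thesis using zygmund_if_pinched[OF \<phi> _ cu] by blast
qed

section \<open>From a pinched support function to an entire graph\<close>

text \<open>The graph function is the Legendre transform of \<open>u\<close>. The lower bound on the Hessian of \<open>u\<close> makes its gradient
blow up at the boundary at least as fast as that of \<open>- lapse\<close>, so the gradient is onto the plane and \<open>f\<close> is entire.
The upper bound becomes the lower bound on the principal curvatures.\<close>

lemma entire_graph_with_support_function:
  fixes u :: "complex \<Rightarrow> real"
  assumes u: "\<And>z. z \<in> ball 0 1 \<Longrightarrow> (u has_derivative inner (g z)) (at z)"
    and g: "\<And>z. z \<in> ball 0 1 \<Longrightarrow> (g has_derivative A z) (at z)"
    and cont: "\<And>w. continuous_on (ball 0 1) (\<lambda>z. A z w)"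
    and lower: "\<And>z w. z \<in> ball 0 1 \<Longrightarrow> inner w (hyp_hess z w) \<le> inner w (A z w)"
    and upper: "\<And>z w. z \<in> ball 0 1 \<Longrightarrow> inner w (A z w) \<le> K * inner w (hyp_hess z w)"
    and K: "K > 0"
  obtains f where "spacelike_entire f" "C2 f" "\<And>p k. k \<in> principal_curvatures f p \<Longrightarrow> 1 / K \<le> k"
    "\<And>z. z \<in> ball 0 1 \<Longrightarrow> support_function (entire_graph f) z = ereal (u z)"
proof -
  have linA: "linear (A z)" if "z \<in> ball 0 1" for z
    using g[OF that] by (simp add: bounded_linear.linear has_derivative_bounded_linear)
  have Age: "(norm w)\<^sup>2 \<le> inner w (A z w)" if "z \<in> ball 0 1" for z w
    using hyp_hess_ge[of z w] lower[OF that, of w] that by simp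
  have Apos: "0 < inner w (A z w)" if "z \<in> ball 0 1" "w \<noteq> 0" for z w
    using Age[OF that(1), of w] that(2) by (meson less_le_trans zero_less_norm_iff zero_less_power)
  have sub: "u z + inner (g z) (y - z) \<le> u y" if "z \<in> ball 0 1" "y \<in> ball 0 1" for y z
    by (rule subgradient_inequality[OF convex_ball u g _ that]) (use Apos in \<open>auto intro: order_trans[OF zero_le_power2 Age]\<close>)
  have radial: "inner (g 0) z + (norm z)\<^sup>2 / lapse z \<le> inner (g z) z" if z: "z \<in> ball 0 1" for z
  proof -
    have "0 \<le> inner ((g z - (1 / lapse z) *\<^sub>R z) - (g 0 - (1 / lapse 0) *\<^sub>R 0)) (z - 0)"
    proof (rule gradient_monotone[where S = "ball 0 1" and A = "\<lambda>z w. A z w - hyp_hess z w"])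
      show "((\<lambda>z. g z - (1 / lapse z) *\<^sub>R z) has_derivative (\<lambda>w. A z w - hyp_hess z w)) (at z)"
        if "z \<in> ball 0 1" for z
        using that by (intro has_derivative_diff g hyp_hess_has_derivative) auto
    qed (use z lower in \<open>auto simp: inner_diff_right\<close>)
    then show ?thesis by (simp add: inner_diff_left dot_square_norm)
  qed
  have inj: "inj_on g (ball 0 1)"
  proof (rule inj_onI, rule ccontr)
    fix x y assume "x \<in> ball 0 1" "y \<in> ball 0 1" "g x = g y" "x \<noteq> y"
    then show False using gradient_strictly_monotone[of "ball 0 1" g A x y] g Apos by simp
  qed
  have surj: "\<exists>z\<in>ball 0 1. g z = p" for p
  proof -
    \<comment> \<open>The radius \<open>r\<close> is chosen so that \<open>r / lapse = N\<close> on the circle of radius \<open>r\<close>; beyond it \<open>p \<bullet> z - u z\<close> does not increase radially.\<close>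
    define N where "N = norm p + norm (g 0) + 1"
    define r where "r = N / sqrt (1 + N\<^sup>2)"
    have N: "N > 0" by (simp add: N_def add_nonneg_pos)
    have q: "sqrt (1 + N\<^sup>2) > 0" by (simp add: add_pos_nonneg)
    have "N < sqrt (1 + N\<^sup>2)" using N by (simp add: real_less_rsqrt)
    then have r: "0 < r" "r < 1" using N q by (auto simp: r_def)
    have r2: "1 - r\<^sup>2 = 1 / (1 + N\<^sup>2)" 
    proof -
      have "1 + N\<^sup>2 \<noteq> 0" by (metis add_pos_nonneg zero_less_one zero_le_power2 less_irrefl)
      then show ?thesis by (simp add: r_def power_divide diff_divide_distrib[symmetric] field_simps)
    qed
    have large: "inner p z \<le> inner (g z) z" if z: "norm z = r" for z
    proof -
      have "lapse z = 1 / sqrt (1 + N\<^sup>2)" by (simp add: lapse_def z r2 real_sqrt_divide)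
      then have "(norm z)\<^sup>2 / lapse z = r * N" 
      proof -
        have "r * sqrt (1 + N\<^sup>2) = N" using q by (simp add: r_def)
        then show ?thesis unfolding \<open>lapse z = _\<close> z by (simp add: power2_eq_square mult.assoc)
      qed
      then have "inner (g 0) z + r * N \<le> inner (g z) z" using radial[of z] z r by simp
      moreover have "\<bar>inner (g 0) z\<bar> \<le> norm (g 0) * r" "\<bar>inner p z\<bar> \<le> norm p * r"
        using Cauchy_Schwarz_ineq2 z by metis+
      moreover have "norm (g 0) * r + norm p * r \<le> r * N" using r by (simp add: N_def algebra_simps)
      ultimately show ?thesis by linarith
    qed
    have "continuous_on (cball 0 r) (\<lambda>z. inner p z - u z)"
    proof (intro continuous_intros)
      show "continuous_on (cball 0 r) u"
        using r by (auto intro!: continuous_at_imp_continuous_on has_derivative_continuous[OF u])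
    qed
    moreover have "cball (0::complex) r \<noteq> {}" using r by simp
    ultimately obtain z0 where z0: "z0 \<in> cball 0 r" "\<And>z. z \<in> cball 0 r \<Longrightarrow> inner p z - u z \<le> inner p z0 - u z0"
      using continuous_attains_sup[OF compact_cball] by blast
    have "inner p z - u z \<le> inner p z0 - u z0" if z: "z \<in> ball 0 1" for z
    proof (cases "norm z \<le> r")
      case False
      then have "z \<noteq> 0" using r by auto
      define y where "y = (r / norm z) *\<^sub>R z"
      have y: "norm y = r" using r \<open>z \<noteq> 0\<close> by (simp add: y_def)
      have zy: "z - y = (norm z / r - 1) *\<^sub>R y" using r \<open>z \<noteq> 0\<close> by (simp add: y_def algebra_simps)
      have "0 \<le> norm z / r - 1" using r False by simp
      then have "inner p (z - y) \<le> inner (g y) (z - y)"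
        unfolding zy using large[OF y] by (simp add: mult_left_mono)
      also have "\<dots> \<le> u z - u y" using sub[of y z] y z r by simp
      finally have "inner p z - u z \<le> inner p y - u y" by (simp add: inner_diff_right)
      also have "\<dots> \<le> inner p z0 - u z0" using z0(2)[of y] y by simp
      finally show ?thesis .
    qed (simp add: z0)
    then have "g z0 = p"
      by (intro gradient_at_interior_maximum[of "ball 0 1" z0 u]) (use z0 r u in auto)
    then show ?thesis using z0 r by auto
  qed
  define Z where "Z = inv_into (ball 0 1) g"
  have Z: "Z p \<in> ball 0 1" "g (Z p) = p" for p
  proof -
    have "p \<in> g ` ball 0 1" using surj[of p] by blast
    then show "Z p \<in> ball 0 1" "g (Z p) = p" unfolding Z_def by (rule inv_into_into, rule f_inv_into_f)
  qed
  have Zg: "Z (g z) = z" if "z \<in> ball 0 1" for z using inj that by (simp add: Z_def)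
  define f where "f p = inner p (Z p) - u (Z p)" for p
  define D where "D p = inv (A (Z p))" for p
  have dZ: "(Z has_derivative D p) (at p)" and df: "(f has_derivative inner (Z p)) (at p)" for p
    using legendre_derivatives[where S = "ball 0 1" and x = "Z p" and g = g and A = A and Z = Z and u = u,
        OF open_ball Z(1) u[OF Z(1)] g Apos[OF Z(1)] Zg]
    unfolding Z(2) f_def[abs_def] D_def by simp_all
  have D: "A (Z p) (D p w) = w" "linear (D p)" for p w
    using positive_definite_inverse[OF linA Apos] Z(1) by (auto simp: D_def)
  have max: "inner q z - u z \<le> f q" if "z \<in> ball 0 1" for q z
    using sub[OF Z(1) that, of q] by (simp add: Z f_def inner_diff_right)
  have small: "norm (Z p) < 1" for p using Z(1)[of p] by simp
  show ?thesis
  proof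
    have "convex_on UNIV f"
    proof (rule convex_on_if_subgradients)
      show "f p + inner (Z p) (q - p) \<le> f q" for p q
        using max[OF Z(1), of q p] by (simp add: f_def inner_diff_right inner_commute)
    qed simp
    moreover have C1f: "C1 f"
      unfolding C1_def
    proof (intro exI[of _ "\<lambda>p. blinfun_inner_right (Z p)"] conjI allI)
      show "continuous_on UNIV (\<lambda>p. blinfun_inner_right (Z p))"
        using dZ by (intro bounded_linear.continuous_on[OF bounded_linear_blinfun_inner_right])
          (meson continuous_at_imp_continuous_on has_derivative_continuous)
    qed (use df in simp)
    moreover have "onorm (frechet_derivative f (at p)) < 1" for p
    proof -
      have "onorm (inner (Z p)) \<le> norm (Z p)"
        by (rule onorm_bound) (auto simp: Cauchy_Schwarz_ineq2)
      then show ?thesis using small[of p] frechet_derivative_at[OF df[of p]] by simp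
    qed
    ultimately show "spacelike_entire f" by (simp add: spacelike_entire_def)
    have blD: "bounded_linear (\<lambda>w. blinfun_inner_right (D p w))" for p
      using bounded_linear_compose[OF bounded_linear_blinfun_inner_right] D(2) linear_conv_bounded_linear by blast
    have contD: "continuous_on UNIV (\<lambda>p. D p w)" for w
    proof (rule continuous_at_imp_continuous_on, rule ballI)
      fix p
      \<comment> \<open>The inverses of the Hessians are contractions, so their continuity follows from that of the Hessians themselves.\<close>
      have le: "norm (D q w - D p w) \<le> norm (A (Z q) (D p w) - A (Z p) (D p w))" for q
      proof -
        let ?x = "D q w - D p w"
        have x: "A (Z q) ?x = - (A (Z q) (D p w) - A (Z p) (D p w))"
          by (simp add: linear_diff[OF linA[OF Z(1)]] D(1))
        have "norm ?x * norm ?x \<le> norm ?x * norm (A (Z q) ?x)"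
          using Age[OF Z(1), of ?x q] norm_cauchy_schwarz[of ?x "A (Z q) ?x"] by (simp add: power2_eq_square)
        then have "norm ?x \<le> norm (A (Z q) ?x)" by (cases "?x = 0") (auto simp: mult_le_cancel_left)
        then show ?thesis unfolding x by (simp only: norm_minus_cancel)
      qed
      have "isCont (\<lambda>q. A (Z q) (D p w)) p"
      proof (rule isCont_o2[of p Z "\<lambda>z. A z (D p w)"])
        show "isCont Z p" using dZ has_derivative_continuous by blast
        show "isCont (\<lambda>z. A z (D p w)) (Z p)"
          using cont Z(1) by (simp add: continuous_on_eq_continuous_at)
      qed
      then have "((\<lambda>q. norm (A (Z q) (D p w) - A (Z p) (D p w))) \<longlongrightarrow> 0) (at p)"
        unfolding isCont_def by (intro tendsto_norm_zero LIM_zero)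
      then have "((\<lambda>q. D q w - D p w) \<longlongrightarrow> 0) (at p)"
        by (rule Lim_null_comparison[rotated]) (rule always_eventually, rule allI, rule le)
      then show "isCont (\<lambda>q. D q w) p" unfolding isCont_def by (rule LIM_zero_cancel)
    qed
    have "C1 (\<lambda>p. blinfun_inner_right (Z p))"
      unfolding C1_def
    proof (intro exI[of _ "\<lambda>p. Blinfun (\<lambda>w. blinfun_inner_right (D p w))"] conjI allI)
      fix p
      show "((\<lambda>p. blinfun_inner_right (Z p)) has_derivative blinfun_apply (Blinfun (\<lambda>w. blinfun_inner_right (D p w)))) (at p)"
        unfolding bounded_linear_Blinfun_apply[OF blD]
        by (rule bounded_linear.has_derivative[OF bounded_linear_blinfun_inner_right dZ])
      show "continuous_on UNIV (\<lambda>p. Blinfun (\<lambda>w. blinfun_inner_right (D p w)))"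
        by (rule continuous_on_blinfun_componentwise)
          (simp add: bounded_linear_Blinfun_apply[OF blD]
            bounded_linear.continuous_on[OF bounded_linear_blinfun_inner_right contD])
    qed
    moreover have "(f has_derivative blinfun_apply (blinfun_inner_right (Z p))) (at p)" for p
      using df by simp
    ultimately show "C2 f" unfolding C2_def by (intro exI[of _ "\<lambda>p. blinfun_inner_right (Z p)"]) fast
    show "1 / K \<le> k" if k: "k \<in> principal_curvatures f p" for p k
    proof -
      obtain w where w: "w \<noteq> 0" "hyp_hess (Z p) (D p w) = k *\<^sub>R w"
        using k unfolding principal_curvatures_eq[OF df small dZ] by auto
      define y where "y = D p w"
      have y: "A (Z p) y = w" "y \<noteq> 0" using w D(1)[of p w] linear_0[OF linA[OF Z(1)]] by (auto simp: y_def)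
      have "0 < inner y w" using Apos[OF Z(1) y(2)] y by metis
      have "inner y w \<le> K * inner y (hyp_hess (Z p) y)" using upper[OF Z(1), of y p] y by simp
      also have "\<dots> = K * k * inner y w" using w by (simp add: y_def)
      finally have "1 \<le> K * k" using \<open>0 < inner y w\<close> by simp
      then show ?thesis using K by (simp add: field_simps)
    qed
    show "support_function (entire_graph f) z = ereal (u z)" if z: "z \<in> ball 0 1" for z
      unfolding support_function_def
    proof (rule antisym)
      show "(SUP x\<in>entire_graph f. ereal (mink x (z, 1))) \<le> ereal (u z)"
      proof (rule SUP_least)
        fix x assume "x \<in> entire_graph f"
        then obtain q where "x = (q, f q)" by (auto simp: entire_graph_def)
        then show "ereal (mink x (z, 1)) \<le> ereal (u z)" using max[OF z, of q] by (simp add: mink_entire_graph)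
      qed
      have "mink (g z, f (g z)) (z, 1) = u z" using Zg[OF z] by (simp add: mink_entire_graph f_def)
      moreover have "(g z, f (g z)) \<in> entire_graph f" by (simp add: entire_graph_def)
      ultimately show "ereal (u z) \<le> (SUP x\<in>entire_graph f. ereal (mink x (z, 1)))"
        by (metis SUP_upper)
    qed
  qed
qed

section \<open>Second differences of a Zygmund function\<close>

text \<open>A Zygmund function deviates from its linear interpolation on an interval of length \<open>e\<close> by \<open>O(e)\<close>. At a maximum \<open>m\<close> of
\<open>|k|\<close>, reflect the nearer endpoint about \<open>m\<close>: the second difference there is at least \<open>|k m|\<close> in modulus.\<close>

lemma zygmund_interpolation:
  fixes k :: "real \<Rightarrow> real"
  assumes e: "0 \<le> e" and k: "continuous_on {0..e} k" "k 0 = 0" "k e = 0"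
    and zyg: "\<And>t h. 0 \<le> h \<Longrightarrow> h \<le> t \<Longrightarrow> t + h \<le> e \<Longrightarrow> \<bar>k (t + h) + k (t - h) - 2 * k t\<bar> \<le> D * h"
    and t: "t \<in> {0..e}"
  shows "2 * \<bar>k t\<bar> \<le> \<bar>D\<bar> * e"
proof -
  have "continuous_on {0..e} (\<lambda>t. \<bar>k t\<bar>)" using k(1) by (intro continuous_intros)
  then obtain m where m: "m \<in> {0..e}" "\<And>s. s \<in> {0..e} \<Longrightarrow> \<bar>k s\<bar> \<le> \<bar>k m\<bar>"
    using continuous_attains_sup[of "{0..e}" "\<lambda>t. \<bar>k t\<bar>"] e by auto
  have "2 * \<bar>k m\<bar> \<le> \<bar>D\<bar> * e"
  proof (cases "m \<le> e / 2")
    case True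
    have "\<bar>k (m + m) + k (m - m) - 2 * k m\<bar> \<le> D * m" using zyg[of m m] m(1) True by simp
    moreover have "\<bar>k (m + m)\<bar> \<le> \<bar>k m\<bar>" using m True by simp
    ultimately have "\<bar>k m\<bar> \<le> D * m" using k(2) by simp
    also have "D * m \<le> \<bar>D\<bar> * (e / 2)" using m(1) True by (intro mult_mono) auto
    finally show ?thesis by simp
  next
    case False
    have "\<bar>k (m + (e - m)) + k (m - (e - m)) - 2 * k m\<bar> \<le> D * (e - m)" using zyg[of "e - m" m] m(1) False by simp
    moreover have "\<bar>k (m - (e - m))\<bar> \<le> \<bar>k m\<bar>" using m False by simp
    ultimately have "\<bar>k m\<bar> \<le> D * (e - m)" using k(3) by simp
    also have "D * (e - m) \<le> \<bar>D\<bar> * (e / 2)" using m(1) False by (intro mult_mono) auto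
    finally show ?thesis by simp
  qed
  then show ?thesis using m(2)[OF t] by linarith
qed

lemma abs_le_if_DERIV_bounded:
  fixes k :: "real \<Rightarrow> real"
  assumes "0 \<le> e" "k 0 = 0" and d: "\<And>t. 0 \<le> t \<Longrightarrow> t \<le> e \<Longrightarrow> (k has_real_derivative k' t) (at t)"
    and b: "\<And>t. 0 \<le> t \<Longrightarrow> t \<le> e \<Longrightarrow> \<bar>k' t\<bar> \<le> B"
  shows "\<bar>k e\<bar> \<le> B * e"
proof (cases "e = 0")
  case False
  then obtain t where t: "0 < t" "t < e" "k e - k 0 = (e - 0) * k' t"
    using MVT2[of 0 e k k'] d assms(1) by auto
  then have "\<bar>k e\<bar> = e * \<bar>k' t\<bar>" using assms by (simp add: abs_mult)
  also have "\<dots> \<le> e * B" using t assms by (intro mult_left_mono b) auto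
  finally show ?thesis by (simp add: mult.commute)
qed (use assms in simp)

text \<open>Here \<open>q\<close> stands for \<open>\<theta> \<mapsto> \<phi> (cis \<theta>)\<close>, with first and second primitives \<open>Q\<close> and \<open>R\<close>. The second difference \<open>E\<close> of \<open>R\<close> is
\<open>e\<^sup>2\<close> times an average of \<open>q\<close> around \<open>\<theta>\<close>. Subscripts denote partial derivatives: \<open>e\<close> for the step and \<open>t\<close> for the
angle. The second derivatives of \<open>E\<close> are sums and differences of values of \<open>q\<close>, so a continuous \<open>q\<close>
suffices for a \<open>C\<^sup>2\<close> smoothing.\<close>

locale zygmund_primitives =
  fixes q Q R :: "real \<Rightarrow> real" and C M :: real
  assumes cont: "continuous_on UNIV q"
    and periodic: "q (t + 2 * pi) = q t"
    and zyg: "\<bar>q (t + h) + q (t - h) - 2 * q t\<bar> \<le> C * \<bar>h\<bar>"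
    and bound: "\<bar>q t\<bar> \<le> M"
    and dQ: "(Q has_real_derivative q t) (at t)"
    and dR: "(R has_real_derivative Q t) (at t)"
begin

definition E :: "real \<Rightarrow> real \<Rightarrow> real" where "E \<theta> e = R (\<theta> + e) + R (\<theta> - e) - 2 * R \<theta>"
definition E\<^sub>e :: "real \<Rightarrow> real \<Rightarrow> real" where "E\<^sub>e \<theta> e = Q (\<theta> + e) - Q (\<theta> - e)"
definition E\<^sub>t :: "real \<Rightarrow> real \<Rightarrow> real" where "E\<^sub>t \<theta> e = Q (\<theta> + e) + Q (\<theta> - e) - 2 * Q \<theta>"
definition E\<^sub>e\<^sub>e :: "real \<Rightarrow> real \<Rightarrow> real" where "E\<^sub>e\<^sub>e \<theta> e = q (\<theta> + e) + q (\<theta> - e)"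
definition E\<^sub>e\<^sub>t :: "real \<Rightarrow> real \<Rightarrow> real" where "E\<^sub>e\<^sub>t \<theta> e = q (\<theta> + e) - q (\<theta> - e)"
definition E\<^sub>t\<^sub>t :: "real \<Rightarrow> real \<Rightarrow> real" where "E\<^sub>t\<^sub>t \<theta> e = q (\<theta> + e) + q (\<theta> - e) - 2 * q \<theta>"

lemma C_nonneg: "0 \<le> C" using zyg[of 0 1] by linarith
lemma M_nonneg: "0 \<le> M" using bound[of 0] by linarith

lemma DERIV_Q [derivative_intros]:
  "(f has_real_derivative f') (at x) \<Longrightarrow> ((\<lambda>x. Q (f x)) has_real_derivative q (f x) * f') (at x)"
  using DERIV_chain2[OF dQ] .
lemma DERIV_R [derivative_intros]:
  "(f has_real_derivative f') (at x) \<Longrightarrow> ((\<lambda>x. R (f x)) has_real_derivative Q (f x) * f') (at x)"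
  using DERIV_chain2[OF dR] .

lemma E\<^sub>t\<^sub>t_bound: "0 \<le> e \<Longrightarrow> \<bar>E\<^sub>t\<^sub>t \<theta> e\<bar> \<le> C * e"
  using zyg[of \<theta> e] by (simp add: E\<^sub>t\<^sub>t_def)

text \<open>The error of \<open>E\<close> relative to its leading term \<open>q \<theta> * e\<^sup>2\<close> is controlled by integrating the Zygmund condition twice in
the step.\<close>

lemma E\<^sub>e\<^sub>e_bound: "0 \<le> e \<Longrightarrow> \<bar>E\<^sub>e\<^sub>e \<theta> e - 2 * q \<theta>\<bar> \<le> C * e"
  using zyg[of \<theta> e] by (simp add: E\<^sub>e\<^sub>e_def)

lemma E\<^sub>e_bound: assumes "0 \<le> e" shows "\<bar>E\<^sub>e \<theta> e - 2 * q \<theta> * e\<bar> \<le> C * e\<^sup>2"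
proof -
  have "\<bar>E\<^sub>e \<theta> e - 2 * q \<theta> * e\<bar> \<le> (C * e) * e"
  proof (rule abs_le_if_DERIV_bounded[where k' = "\<lambda>e. E\<^sub>e\<^sub>e \<theta> e - 2 * q \<theta>"])
    show "((\<lambda>e. E\<^sub>e \<theta> e - 2 * q \<theta> * e) has_real_derivative E\<^sub>e\<^sub>e \<theta> t - 2 * q \<theta>) (at t)" for t
      unfolding E\<^sub>e_def E\<^sub>e\<^sub>e_def by (auto intro!: derivative_eq_intros)
    show "\<bar>E\<^sub>e\<^sub>e \<theta> t - 2 * q \<theta>\<bar> \<le> C * e" if "0 \<le> t" "t \<le> e" for t
      using E\<^sub>e\<^sub>e_bound[OF that(1)] mult_left_mono[OF that(2) C_nonneg] by (rule order_trans)
  qed (use assms in \<open>auto simp: E\<^sub>e_def\<close>)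
  then show ?thesis by (simp add: power2_eq_square mult.assoc)
qed

lemma E_bound: assumes "0 \<le> e" shows "\<bar>E \<theta> e - q \<theta> * e\<^sup>2\<bar> \<le> C * e ^ 3"
proof -
  have "\<bar>E \<theta> e - q \<theta> * e\<^sup>2\<bar> \<le> (C * e\<^sup>2) * e"
  proof (rule abs_le_if_DERIV_bounded[where k' = "\<lambda>e. E\<^sub>e \<theta> e - 2 * q \<theta> * e"])
    show "((\<lambda>e. E \<theta> e - q \<theta> * e\<^sup>2) has_real_derivative E\<^sub>e \<theta> t - 2 * q \<theta> * t) (at t)" for t
      unfolding E\<^sub>e_def E_def by (auto intro!: derivative_eq_intros)
    show "\<bar>E\<^sub>e \<theta> t - 2 * q \<theta> * t\<bar> \<le> C * e\<^sup>2" if "0 \<le> t" "t \<le> e" for t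
      using E\<^sub>e_bound[OF that(1)] mult_left_mono[OF power_mono[OF that(2,1), of 2] C_nonneg] by (rule order_trans)
  qed (use assms in \<open>auto simp: E_def\<close>)
  then show ?thesis by (simp add: power2_eq_square power3_eq_cube mult.assoc)
qed

lemma E\<^sub>t_bound: assumes "0 \<le> e" shows "\<bar>E\<^sub>t \<theta> e\<bar> \<le> 2 * M * e"
proof (rule abs_le_if_DERIV_bounded[OF assms, where k' = "\<lambda>e. E\<^sub>e\<^sub>t \<theta> e"])
  show "((\<lambda>e. E\<^sub>t \<theta> e) has_real_derivative E\<^sub>e\<^sub>t \<theta> t) (at t)" for t
    unfolding E\<^sub>t_def E\<^sub>e\<^sub>t_def by (auto intro!: derivative_eq_intros)
  show "\<bar>E\<^sub>e\<^sub>t \<theta> t\<bar> \<le> 2 * M" for t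
    using bound[of "\<theta> + t"] bound[of "\<theta> - t"] by (simp add: E\<^sub>e\<^sub>t_def)
qed (simp add: E\<^sub>t_def)

text \<open>The estimate behind the mixed second derivative. The first difference \<open>t \<mapsto> E\<^sub>e\<^sub>t \<theta> t\<close> need not be \<open>O(t)\<close>, since a Zygmund
function need not be Lipschitz; only after subtracting its linear interpolation between \<open>0\<close> and \<open>e\<close> is it \<open>O(e)\<close>, and
the subtracted part contributes exactly \<open>e / 2 * E\<^sub>e\<^sub>t \<theta> e\<close> to its integral \<open>E\<^sub>t\<close>.\<close>

lemma E\<^sub>t_E\<^sub>e\<^sub>t_bound: assumes "0 < e" shows "\<bar>E\<^sub>t \<theta> e - e / 2 * E\<^sub>e\<^sub>t \<theta> e\<bar> \<le> C * e\<^sup>2"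
proof -
  let ?k = "\<lambda>t. E\<^sub>e\<^sub>t \<theta> t - t / e * E\<^sub>e\<^sub>t \<theta> e"
  have "\<bar>E\<^sub>t \<theta> e - e\<^sup>2 / (2 * e) * E\<^sub>e\<^sub>t \<theta> e\<bar> \<le> (C * e) * e"
  proof (rule abs_le_if_DERIV_bounded[where k' = ?k and k = "\<lambda>t. E\<^sub>t \<theta> t - t\<^sup>2 / (2 * e) * E\<^sub>e\<^sub>t \<theta> e"])
    show "((\<lambda>t. E\<^sub>t \<theta> t - t\<^sup>2 / (2 * e) * E\<^sub>e\<^sub>t \<theta> e) has_real_derivative ?k t) (at t)" for t
      unfolding E\<^sub>t_def E\<^sub>e\<^sub>t_def using assms by (auto intro!: derivative_eq_intros)
    fix t assume t: "0 \<le> t" "t \<le> e"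
    have "2 * \<bar>?k t\<bar> \<le> \<bar>2 * C\<bar> * e"
    proof (rule zygmund_interpolation[where k = ?k])
      show "continuous_on {0..e} ?k" unfolding E\<^sub>e\<^sub>t_def
        using assms by (intro continuous_intros continuous_on_compose2[OF cont]) auto
      show "\<bar>?k (t + h) + ?k (t - h) - 2 * ?k t\<bar> \<le> (2 * C) * h" if "0 \<le> h" for t h
      proof -
        have "?k (t + h) + ?k (t - h) - 2 * ?k t = (q ((\<theta> + t) + h) + q ((\<theta> + t) - h) - 2 * q (\<theta> + t))
            - (q ((\<theta> - t) + h) + q ((\<theta> - t) - h) - 2 * q (\<theta> - t))"
          using assms by (simp add: E\<^sub>e\<^sub>t_def field_simps)
        then show ?thesis using zyg[of "\<theta> + t" h] zyg[of "\<theta> - t" h] that by (simp add: abs_le_iff)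
      qed
    qed (use assms t in \<open>auto simp: E\<^sub>e\<^sub>t_def\<close>)
    then show "\<bar>?k t\<bar> \<le> C * e" using C_nonneg by simp
  qed (use assms in \<open>auto simp: E\<^sub>t_def\<close>)
  then show ?thesis using assms by (simp add: power2_eq_square mult.assoc)
qed

lemma Q_shift: "Q (t + 2 * pi) - Q t = Q (s + 2 * pi) - Q s"
proof -
  have "((\<lambda>t. Q (t + 2 * pi) - Q t) has_real_derivative 0) (at t)" for t
    by (auto intro!: derivative_eq_intros simp: periodic)
  then show ?thesis using DERIV_isconst_all[of "\<lambda>t. Q (t + 2 * pi) - Q t"] by blast
qed

text \<open>The primitives are periodic only up to an affine function, which second differences annihilate.\<close>

lemma R_shift: "R (t + 2 * pi) - R t - (Q (2 * pi) - Q 0) * t = R (2 * pi) - R 0"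
proof -
  have "((\<lambda>t. R (t + 2 * pi) - R t - (Q (2 * pi) - Q 0) * t) has_real_derivative 0) (at t)" for t
    using Q_shift[of t 0] by (auto intro!: derivative_eq_intros)
  then show ?thesis using DERIV_isconst_all[of "\<lambda>t. R (t + 2 * pi) - R t - (Q (2 * pi) - Q 0) * t" t 0] by simp
qed

lemma periodic_differences:
  "E (\<theta> + 2 * pi) e = E \<theta> e" "E\<^sub>e (\<theta> + 2 * pi) e = E\<^sub>e \<theta> e" "E\<^sub>t (\<theta> + 2 * pi) e = E\<^sub>t \<theta> e"
  "E\<^sub>e\<^sub>e (\<theta> + 2 * pi) e = E\<^sub>e\<^sub>e \<theta> e" "E\<^sub>e\<^sub>t (\<theta> + 2 * pi) e = E\<^sub>e\<^sub>t \<theta> e" "E\<^sub>t\<^sub>t (\<theta> + 2 * pi) e = E\<^sub>t\<^sub>t \<theta> e"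
proof -
  have sh: "\<theta> + 2 * pi + e = \<theta> + e + 2 * pi" "\<theta> + 2 * pi - e = \<theta> - e + 2 * pi" by auto
  show "E\<^sub>e\<^sub>e (\<theta> + 2 * pi) e = E\<^sub>e\<^sub>e \<theta> e" "E\<^sub>e\<^sub>t (\<theta> + 2 * pi) e = E\<^sub>e\<^sub>t \<theta> e" "E\<^sub>t\<^sub>t (\<theta> + 2 * pi) e = E\<^sub>t\<^sub>t \<theta> e"
    unfolding E\<^sub>e\<^sub>e_def E\<^sub>e\<^sub>t_def E\<^sub>t\<^sub>t_def sh periodic by (rule refl)+
  show "E\<^sub>e (\<theta> + 2 * pi) e = E\<^sub>e \<theta> e" "E\<^sub>t (\<theta> + 2 * pi) e = E\<^sub>t \<theta> e"
    unfolding E\<^sub>e_def E\<^sub>t_def sh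
    using Q_shift[of "\<theta> + e" 0] Q_shift[of "\<theta> - e" 0] Q_shift[of \<theta> 0] by simp_all
  show "E (\<theta> + 2 * pi) e = E \<theta> e"
    unfolding E_def sh
    using R_shift[of "\<theta> + e"] R_shift[of "\<theta> - e"] R_shift[of \<theta>] by (simp add: algebra_simps)
qed

section \<open>The smoothing in logarithmic coordinates\<close>

text \<open>In the coordinate \<open>\<zeta> = ln |z| + i arg z\<close> the smoothing scale is \<open>depth \<zeta> = sqrt (- Re \<zeta>)\<close>, comparable to \<open>lapse z\<close>
away from the centre. Subscripts \<open>r\<close> and \<open>t\<close> denote the derivatives in \<open>Re \<zeta>\<close> and \<open>Im \<zeta>\<close>. Expressed through
\<open>inv_depth\<close>, all derivatives are polynomial in the second differences, so that the differentiations below are ring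
identities.\<close>

definition depth :: "complex \<Rightarrow> real" where "depth \<zeta> = sqrt (- Re \<zeta>)"

lemma depth_derivative [derivative_intros]:
  "Re \<zeta> < 0 \<Longrightarrow> (depth has_derivative (\<lambda>w. - Re w / (2 * depth \<zeta>))) (at \<zeta>)"
  unfolding depth_def by (auto intro!: derivative_eq_intros simp: field_simps)

lemma depth_pos: "Re \<zeta> < 0 \<Longrightarrow> 0 < depth \<zeta>" by (simp add: depth_def)

definition inv_depth :: "complex \<Rightarrow> real" where "inv_depth \<zeta> = 1 / depth \<zeta>"

lemma inv_depth_derivative:
  assumes "Re \<zeta> < 0"
  shows "(inv_depth has_derivative (\<lambda>w. Re w * inv_depth \<zeta> ^ 3 / 2)) (at \<zeta>)"
  unfolding inv_depth_def[abs_def]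
  by (rule has_derivative_eq_rhs, (rule derivative_intros depth_derivative assms)+)
    (use depth_pos[OF assms] in \<open>auto simp: fun_eq_iff power3_eq_cube\<close>)

definition H :: "complex \<Rightarrow> real" where "H \<zeta> = E (Im \<zeta>) (depth \<zeta>) * inv_depth \<zeta> ^ 2"
definition H\<^sub>r :: "complex \<Rightarrow> real" where
  "H\<^sub>r \<zeta> = E (Im \<zeta>) (depth \<zeta>) * inv_depth \<zeta> ^ 4 - (1/2) * (E\<^sub>e (Im \<zeta>) (depth \<zeta>) * inv_depth \<zeta> ^ 3)"
definition H\<^sub>t :: "complex \<Rightarrow> real" where "H\<^sub>t \<zeta> = E\<^sub>t (Im \<zeta>) (depth \<zeta>) * inv_depth \<zeta> ^ 2"
definition H\<^sub>r\<^sub>r :: "complex \<Rightarrow> real" where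
  "H\<^sub>r\<^sub>r \<zeta> = (1/4) * (E\<^sub>e\<^sub>e (Im \<zeta>) (depth \<zeta>) * inv_depth \<zeta> ^ 4)
     - (5/4) * (E\<^sub>e (Im \<zeta>) (depth \<zeta>) * inv_depth \<zeta> ^ 5) + 2 * (E (Im \<zeta>) (depth \<zeta>) * inv_depth \<zeta> ^ 6)"
definition H\<^sub>r\<^sub>t :: "complex \<Rightarrow> real" where
  "H\<^sub>r\<^sub>t \<zeta> = E\<^sub>t (Im \<zeta>) (depth \<zeta>) * inv_depth \<zeta> ^ 4 - (1/2) * (E\<^sub>e\<^sub>t (Im \<zeta>) (depth \<zeta>) * inv_depth \<zeta> ^ 3)"
definition H\<^sub>t\<^sub>t :: "complex \<Rightarrow> real" where "H\<^sub>t\<^sub>t \<zeta> = E\<^sub>t\<^sub>t (Im \<zeta>) (depth \<zeta>) * inv_depth \<zeta> ^ 2"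

lemma Q_R_has_derivative:
  assumes "(f has_derivative f') (at x)"
  shows "((\<lambda>x. Q (f x)) has_derivative (\<lambda>w. f' w * q (f x))) (at x)"
    "((\<lambda>x. R (f x)) has_derivative (\<lambda>w. f' w * Q (f x))) (at x)"
  using DERIV_compose_FDERIV[OF dQ assms] DERIV_compose_FDERIV[OF dR assms] .

lemma differences_have_derivative:
  assumes "Re \<zeta> < 0"
  shows "((\<lambda>\<zeta>. E (Im \<zeta>) (depth \<zeta>)) has_derivative
      (\<lambda>w. E\<^sub>t (Im \<zeta>) (depth \<zeta>) * Im w - E\<^sub>e (Im \<zeta>) (depth \<zeta>) * Re w * inv_depth \<zeta> / 2)) (at \<zeta>)"
    "((\<lambda>\<zeta>. E\<^sub>e (Im \<zeta>) (depth \<zeta>)) has_derivative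
      (\<lambda>w. E\<^sub>e\<^sub>t (Im \<zeta>) (depth \<zeta>) * Im w - E\<^sub>e\<^sub>e (Im \<zeta>) (depth \<zeta>) * Re w * inv_depth \<zeta> / 2)) (at \<zeta>)"
    "((\<lambda>\<zeta>. E\<^sub>t (Im \<zeta>) (depth \<zeta>)) has_derivative
      (\<lambda>w. E\<^sub>t\<^sub>t (Im \<zeta>) (depth \<zeta>) * Im w - E\<^sub>e\<^sub>t (Im \<zeta>) (depth \<zeta>) * Re w * inv_depth \<zeta> / 2)) (at \<zeta>)"
  unfolding E_def E\<^sub>e_def E\<^sub>t_def E\<^sub>e\<^sub>e_def E\<^sub>e\<^sub>t_def E\<^sub>t\<^sub>t_def inv_depth_def
  by (rule has_derivative_eq_rhs, (rule Q_R_has_derivative depth_derivative assms derivative_intros)+,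
      simp add: fun_eq_iff algebra_simps add_divide_distrib diff_divide_distrib)+

lemma H_has_derivative:
  assumes "Re \<zeta> < 0"
  shows "(H has_derivative (\<lambda>w. H\<^sub>r \<zeta> * Re w + H\<^sub>t \<zeta> * Im w)) (at \<zeta>)"
    "(H\<^sub>r has_derivative (\<lambda>w. H\<^sub>r\<^sub>r \<zeta> * Re w + H\<^sub>r\<^sub>t \<zeta> * Im w)) (at \<zeta>)"
    "(H\<^sub>t has_derivative (\<lambda>w. H\<^sub>r\<^sub>t \<zeta> * Re w + H\<^sub>t\<^sub>t \<zeta> * Im w)) (at \<zeta>)"
  unfolding H_def[abs_def] H\<^sub>r_def[abs_def] H\<^sub>t_def[abs_def] H\<^sub>r\<^sub>r_def H\<^sub>r\<^sub>t_def H\<^sub>t\<^sub>t_def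
  by (rule has_derivative_eq_rhs,
      (rule differences_have_derivative inv_depth_derivative assms derivative_intros)+,
      simp add: fun_eq_iff algebra_simps eval_nat_numeral)+

lemma depth_cancel:
  assumes "Re \<zeta> < 0"
  shows "depth \<zeta> ^ m * inv_depth \<zeta> ^ (m + n) = inv_depth \<zeta> ^ n"
  using depth_pos[OF assms] by (simp add: inv_depth_def power_add power_one_over)

lemma H_bound:
  assumes "Re \<zeta> < 0" shows "\<bar>H \<zeta> - q (Im \<zeta>)\<bar> \<le> C * depth \<zeta>"
proof -
  let ?e = "depth \<zeta>" and ?y = "inv_depth \<zeta>"
  have e: "0 < ?e" using depth_pos[OF assms] .
  have y: "0 < ?y" using e by (simp add: inv_depth_def)
  have c: "?e\<^sup>2 * ?y\<^sup>2 = 1" "?e ^ 3 * ?y\<^sup>2 = ?e"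
    using e by (simp_all add: inv_depth_def eval_nat_numeral)
  have "H \<zeta> - q (Im \<zeta>) = (E (Im \<zeta>) ?e - q (Im \<zeta>) * ?e\<^sup>2) * ?y\<^sup>2"
    using c by (simp add: H_def left_diff_distrib mult.assoc)
  then have "\<bar>H \<zeta> - q (Im \<zeta>)\<bar> = \<bar>E (Im \<zeta>) ?e - q (Im \<zeta>) * ?e\<^sup>2\<bar> * ?y\<^sup>2"
    by (simp add: abs_mult)
  also have "\<dots> \<le> C * ?e ^ 3 * ?y\<^sup>2" using e by (intro mult_right_mono E_bound) auto
  also have "\<dots> = C * ?e" using c by (simp add: mult.assoc)
  finally show ?thesis .
qed

text \<open>In \<open>H\<^sub>r\<close> and \<open>H\<^sub>r\<^sub>r\<close> the contributions of the leading terms \<open>2 q\<close>, \<open>2 q e\<close> and \<open>q e\<^sup>2\<close> cancel, as they must because a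
constant \<open>q\<close> is reproduced exactly; only the errors \<open>a\<close>, \<open>b\<close>, \<open>c\<close> remain, and these are smaller by a factor \<open>e\<close>. In \<open>H\<^sub>t\<close> the crude bound
of order \<open>1 / e\<close> is enough.\<close>

lemma H_derivative_bounds:
  assumes "Re \<zeta> < 0"
  shows "\<bar>H\<^sub>r \<zeta>\<bar> \<le> 2 * C * inv_depth \<zeta>"
    "\<bar>H\<^sub>t \<zeta>\<bar> \<le> 2 * M * inv_depth \<zeta>"
    "\<bar>H\<^sub>r\<^sub>r \<zeta>\<bar> \<le> 4 * C * inv_depth \<zeta> ^ 3"
    "\<bar>H\<^sub>r\<^sub>t \<zeta>\<bar> \<le> C * inv_depth \<zeta> ^ 2"
    "\<bar>H\<^sub>t\<^sub>t \<zeta>\<bar> \<le> C * inv_depth \<zeta>"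
proof -
  define e where "e = depth \<zeta>"
  define y where "y = inv_depth \<zeta>"
  define p where "p = q (Im \<zeta>)"
  define a where "a = E\<^sub>e\<^sub>e (Im \<zeta>) e - 2 * p"
  define b where "b = E\<^sub>e (Im \<zeta>) e - 2 * p * e"
  define c where "c = E (Im \<zeta>) e - p * e\<^sup>2"
  have e: "0 < e" using depth_pos[OF assms] by (simp add: e_def)
  have y: "0 < y" using e by (simp add: y_def inv_depth_def e_def)
  have can: "e ^ m * y ^ (m + n) = y ^ n" for m n
    unfolding e_def y_def by (rule depth_cancel[OF assms])
  have u: "e * y = 1" using e by (simp add: y_def e_def inv_depth_def)
  have ey: "e * y ^ 2 = y" "e * y ^ 3 = y ^ 2" "e * y ^ 4 = y ^ 3" "e * y ^ 5 = y ^ 4"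
    "e\<^sup>2 * y ^ 3 = y" "e\<^sup>2 * y ^ 4 = y ^ 2" "e\<^sup>2 * y ^ 5 = y ^ 3" "e\<^sup>2 * y ^ 6 = y ^ 4"
    "e ^ 3 * y ^ 4 = y" "e ^ 3 * y ^ 6 = y ^ 3"
    using u can[of 1 3] can[of 1 4] can[of 2 1] can[of 2 2] can[of 2 3] can[of 2 4]
      can[of 3 1] can[of 3 3]
    by (simp_all add: power2_eq_square[of y] power3_eq_cube[of y] mult.assoc[symmetric])
  have a: "\<bar>a\<bar> \<le> C * e" using E\<^sub>e\<^sub>e_bound[of e] e by (simp add: a_def p_def)
  have b: "\<bar>b\<bar> \<le> C * e\<^sup>2" using E\<^sub>e_bound[of e] e by (simp add: b_def p_def)
  have c: "\<bar>c\<bar> \<le> C * e ^ 3" using E_bound[of e] e by (simp add: c_def p_def)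
  have Cy: "0 \<le> C * y" "0 \<le> C * y ^ 3" using y C_nonneg by simp_all
  have "H\<^sub>r \<zeta> = c * y ^ 4 - (1/2) * (b * y ^ 3) + p * (e\<^sup>2 * y ^ 4 - e * y ^ 3)"
    by (simp add: H\<^sub>r_def b_def c_def algebra_simps flip: e_def y_def)
  then have "\<bar>H\<^sub>r \<zeta>\<bar> \<le> \<bar>c * y ^ 4\<bar> + \<bar>b * y ^ 3\<bar>" unfolding ey by (simp add: abs_le_iff) linarith
  also have "\<dots> = \<bar>c\<bar> * y ^ 4 + \<bar>b\<bar> * y ^ 3" using y by (simp add: abs_mult)
  also have "\<dots> \<le> (C * e ^ 3) * y ^ 4 + (C * e\<^sup>2) * y ^ 3"
    using y by (intro add_mono mult_right_mono b c) auto
  also have "\<dots> = 2 * C * y" unfolding mult.assoc ey by simp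
  finally show "\<bar>H\<^sub>r \<zeta>\<bar> \<le> 2 * C * inv_depth \<zeta>" by (simp add: y_def)
  have "\<bar>H\<^sub>t \<zeta>\<bar> = \<bar>E\<^sub>t (Im \<zeta>) e\<bar> * y\<^sup>2" by (simp add: H\<^sub>t_def abs_mult flip: e_def y_def)
  also have "\<dots> \<le> (2 * M * e) * y\<^sup>2" using e by (intro mult_right_mono E\<^sub>t_bound) auto
  also have "\<dots> = 2 * M * y" unfolding mult.assoc ey ..
  finally show "\<bar>H\<^sub>t \<zeta>\<bar> \<le> 2 * M * inv_depth \<zeta>" by (simp add: y_def)
  have "H\<^sub>r\<^sub>r \<zeta> = (1/4) * (a * y ^ 4) - (5/4) * (b * y ^ 5) + 2 * (c * y ^ 6)
      + p * (y ^ 4 / 2 - (5/2) * (e * y ^ 5) + 2 * (e\<^sup>2 * y ^ 6))"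
    by (simp add: H\<^sub>r\<^sub>r_def a_def b_def c_def algebra_simps flip: e_def y_def)
  then have "\<bar>H\<^sub>r\<^sub>r \<zeta>\<bar> \<le> (1/4) * \<bar>a * y ^ 4\<bar> + (5/4) * \<bar>b * y ^ 5\<bar> + 2 * \<bar>c * y ^ 6\<bar>"
    unfolding ey by (simp add: abs_le_iff) linarith
  also have "\<dots> = (1/4) * (\<bar>a\<bar> * y ^ 4) + (5/4) * (\<bar>b\<bar> * y ^ 5) + 2 * (\<bar>c\<bar> * y ^ 6)"
    using y by (simp add: abs_mult)
  also have "\<dots> \<le> (1/4) * ((C * e) * y ^ 4) + (5/4) * ((C * e\<^sup>2) * y ^ 5) + 2 * ((C * e ^ 3) * y ^ 6)"
    using y by (intro add_mono mult_right_mono mult_left_mono a b c) auto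
  also have "\<dots> \<le> 4 * C * y ^ 3" unfolding mult.assoc ey using Cy by simp
  finally show "\<bar>H\<^sub>r\<^sub>r \<zeta>\<bar> \<le> 4 * C * inv_depth \<zeta> ^ 3" by (simp add: y_def)
  have "H\<^sub>r\<^sub>t \<zeta> = E\<^sub>t (Im \<zeta>) e * y ^ 4 - (1/2) * E\<^sub>e\<^sub>t (Im \<zeta>) e * (e * y ^ 4)"
    unfolding ey by (simp add: H\<^sub>r\<^sub>t_def flip: e_def y_def)
  also have "\<dots> = (E\<^sub>t (Im \<zeta>) e - e / 2 * E\<^sub>e\<^sub>t (Im \<zeta>) e) * y ^ 4" by (simp add: algebra_simps)
  finally have "\<bar>H\<^sub>r\<^sub>t \<zeta>\<bar> = \<bar>E\<^sub>t (Im \<zeta>) e - e / 2 * E\<^sub>e\<^sub>t (Im \<zeta>) e\<bar> * y ^ 4"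
    using y by (simp add: abs_mult)
  also have "\<dots> \<le> (C * e\<^sup>2) * y ^ 4" using e y by (intro mult_right_mono E\<^sub>t_E\<^sub>e\<^sub>t_bound) auto
  also have "\<dots> = C * y ^ 2" unfolding mult.assoc ey ..
  finally show "\<bar>H\<^sub>r\<^sub>t \<zeta>\<bar> \<le> C * inv_depth \<zeta> ^ 2" by (simp add: y_def)
  have "\<bar>H\<^sub>t\<^sub>t \<zeta>\<bar> = \<bar>E\<^sub>t\<^sub>t (Im \<zeta>) e\<bar> * y\<^sup>2" by (simp add: H\<^sub>t\<^sub>t_def abs_mult flip: e_def y_def)
  also have "\<dots> \<le> (C * e) * y\<^sup>2" using e by (intro mult_right_mono E\<^sub>t\<^sub>t_bound) auto
  also have "\<dots> = C * y" unfolding mult.assoc ey ..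
  finally show "\<bar>H\<^sub>t\<^sub>t \<zeta>\<bar> \<le> C * inv_depth \<zeta>" by (simp add: y_def)
qed

end

section \<open>Logarithmic coordinates on the punctured disc\<close>

lemma max_power_has_derivative:
  "((\<lambda>x::real. max 0 x ^ Suc (Suc n)) has_real_derivative real (Suc (Suc n)) * max 0 x ^ Suc n) (at x)"
proof -
  consider "x < 0" | "x = 0" | "x > 0" by linarith
  then show ?thesis
  proof cases
    case 1
    have "((\<lambda>x::real. 0) has_real_derivative real (Suc (Suc n)) * max 0 x ^ Suc n) (at x)"
      using 1 by simp
    then show ?thesis
      by (rule has_field_derivative_transform_within_open[where S = "{..<0}"]) (use 1 in auto)
  next
    case 3
    have "((\<lambda>x::real. x ^ Suc (Suc n)) has_real_derivative real (Suc (Suc n)) * max 0 x ^ Suc n) (at x)"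
      using 3 DERIV_pow[of "Suc (Suc n)" x] by simp
    then show ?thesis
      by (rule has_field_derivative_transform_within_open[where S = "{0<..}"]) (use 3 in auto)
  next
    case 2
    have "((\<lambda>h::real. max 0 h ^ Suc (Suc n) / h) \<longlongrightarrow> 0) (at 0)"
    proof (rule Lim_null_comparison)
      show "\<forall>\<^sub>F h in at 0. norm (max 0 h ^ Suc (Suc n) / h) \<le> \<bar>h\<bar> ^ Suc n"
      proof (rule always_eventually, rule allI)
        show "norm (max 0 h ^ Suc (Suc n) / h) \<le> \<bar>h\<bar> ^ Suc n" for h :: real
        proof (cases "h \<le> 0")
          case True
          then have "max 0 h = 0" by simp
          then show ?thesis by (simp del: power_Suc add: power_0_Suc)
        qed simp
      qed
      have "((\<lambda>h::real. \<bar>h\<bar> ^ Suc n) \<longlongrightarrow> \<bar>0\<bar> ^ Suc n) (at 0)" by (intro tendsto_intros)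
      then show "((\<lambda>h::real. \<bar>h\<bar> ^ Suc n) \<longlongrightarrow> 0) (at 0)" by simp
    qed
    then show ?thesis using 2 by (simp add: DERIV_def)
  qed
qed

text \<open>A function with period \<open>2 \<pi> \<i>\<close> descends along the exponential. This makes compositions with the discontinuous
principal branch \<open>Ln\<close> differentiable on the whole punctured plane.\<close>

lemma periodic_exp_eq:
  fixes X :: "complex \<Rightarrow> 'a"
  assumes per: "\<And>\<zeta>. X (\<zeta> + 2 * of_real pi * \<i>) = X \<zeta>" and "exp a = exp b"
  shows "X a = X b"
proof -
  have nat: "X (\<zeta> + of_nat n * (2 * of_real pi * \<i>)) = X \<zeta>" for \<zeta> and n :: nat
  proof (induction n)
    case (Suc n)
    have "X (\<zeta> + of_nat (Suc n) * (2 * of_real pi * \<i>)) = X ((\<zeta> + of_nat n * (2 * of_real pi * \<i>)) + 2 * of_real pi * \<i>)"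
      by (simp add: algebra_simps)
    then show ?case using Suc by (simp only: per)
  qed simp
  obtain n :: int where n: "a = b + (of_int (2 * n) * pi) * \<i>" using assms(2) exp_eq by blast
  show ?thesis
  proof (cases "n \<ge> 0")
    case True
    then show ?thesis using nat[of b "nat n"] n by (simp add: of_nat_nat mult_ac)
  next
    case False
    then show ?thesis using nat[of a "nat (- n)"] n by (simp add: of_nat_nat mult_ac)
  qed
qed

text \<open>Near any \<open>z \<noteq> 0\<close> the function \<open>L\<close> is a differentiable branch of the logarithm that agrees with \<open>Ln\<close> at \<open>z\<close>, on
the negative axis as elsewhere.\<close>

lemma Ln_branch:
  assumes "z \<noteq> 0"
  defines "L \<equiv> \<lambda>x. Ln (x / z) + Ln z"
  shows "(L has_derivative (\<lambda>w. w / z)) (at z)" "L z = Ln z" "x \<noteq> 0 \<Longrightarrow> exp (L x) = exp (Ln x)"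
proof -
  have "(L has_field_derivative 1 / z) (at z)"
    unfolding L_def using assms(1) by (auto intro!: derivative_eq_intros simp: complex_nonpos_Reals_iff)
  then show "(L has_derivative (\<lambda>w. w / z)) (at z)" unfolding has_field_derivative_def
    by (rule has_derivative_eq_rhs) (simp add: fun_eq_iff)
  show "L z = Ln z" "x \<noteq> 0 \<Longrightarrow> exp (L x) = exp (Ln x)" using assms(1) by (simp_all add: L_def exp_add)
qed

lemma periodic_Ln_has_derivative:
  assumes per: "\<And>\<zeta>. X (\<zeta> + 2 * of_real pi * \<i>) = X \<zeta>" and z: "z \<noteq> 0"
    and D: "(X has_derivative D) (at (Ln z))"
  shows "((\<lambda>z. X (Ln z)) has_derivative (\<lambda>w. D (w / z))) (at z)"
proof -
  let ?L = "\<lambda>x. Ln (x / z) + Ln z"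
  note L = Ln_branch[OF z]
  have "((\<lambda>x. X (?L x)) has_derivative (\<lambda>w. D (w / z))) (at z)"
    using has_derivative_compose[OF L(1), of X D] D L(2) by simp
  then show ?thesis
    by (rule has_derivative_transform_within_open[of _ _ _ _ "- {0}"])
      (use z L(3) in \<open>auto intro!: periodic_exp_eq[of X] per\<close>)
qed

lemma periodic_Ln_isCont:
  fixes X :: "complex \<Rightarrow> 'a::t2_space"
  assumes per: "\<And>\<zeta>. X (\<zeta> + 2 * of_real pi * \<i>) = X \<zeta>" and z: "z \<noteq> 0"
    and X: "isCont X (Ln z)"
  shows "isCont (\<lambda>z. X (Ln z)) z"
proof -
  let ?L = "\<lambda>x. Ln (x / z) + Ln z"
  note L = Ln_branch[OF z]
  have "isCont (\<lambda>x. X (?L x)) z"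
    using L(1,2) X by (intro isCont_o2[of z ?L X] has_derivative_continuous) auto
  moreover have "\<forall>\<^sub>F x in nhds z. X (?L x) = X (Ln x)"
    unfolding eventually_nhds
    by (rule exI[of _ "- {0}"]) (use z L(3) in \<open>auto intro!: periodic_exp_eq[of X] per\<close>)
  ultimately show ?thesis using isCont_cong[of "\<lambda>x. X (?L x)" "\<lambda>x. X (Ln x)" z] by simp
qed

lemma inner_divide_cnj: "inner w (a / cnj z) = inner (w / z) a" for w a z :: complex
proof -
  have re: "inner x y = Re (cnj x * y)" for x y :: complex by (simp add: inner_complex_def)
  show ?thesis unfolding re by simp
qed

lemma lapse_le_log:
  assumes "z \<noteq> 0" "norm z < 1"
  shows "lapse z \<le> 2 * sqrt (- ln (norm z))"
proof -
  have "1 + 2 * ln (norm z) \<le> exp (2 * ln (norm z))" by (rule exp_ge_add_one_self)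
  also have "\<dots> = (norm z)\<^sup>2" using assms by (simp add: exp_double)
  finally have "1 - (norm z)\<^sup>2 \<le> 2 * (- ln (norm z))" by simp
  also have "\<dots> \<le> 4 * (- ln (norm z))" using assms by simp
  finally have "lapse z \<le> sqrt (4 * (- ln (norm z)))" unfolding lapse_def by (rule real_sqrt_le_mono)
  then show ?thesis by (simp only: real_sqrt_mult) simp
qed

text \<open>The real and imaginary parts of \<open>w / z\<close> are the radial and tangential components of \<open>w\<close>, divided by \<open>|z|\<close>. The factor
\<open>81\<close> absorbs \<open>|z|\<^sup>4\<close>, as \<open>|z| \<ge> exp (- 1) \<ge> 1 / 3\<close>.\<close>

lemma hyp_hess_log_coordinates:
  assumes z: "exp (-1) \<le> norm z" "norm z < 1"
  shows "(Re (w / z))\<^sup>2 / lapse z ^ 3 + (Im (w / z))\<^sup>2 / lapse z \<le> 81 * inner w (hyp_hess z w)"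
proof -
  define \<omega> where "\<omega> = w / z"
  define r where "r = norm z"
  define s where "s = lapse z"
  have s: "s > 0" using lapse_pos z by (simp add: s_def)
  have "(0::real) < exp (-1)" by simp
  then have "0 < r" using z unfolding r_def by linarith
  then have w: "w = \<omega> * z" by (auto simp: \<omega>_def r_def)
  have "1 / 3 \<le> exp (- 1 :: real)" using exp_le by (simp add: exp_minus field_simps)
  then have r: "1 / 3 \<le> r" using z by (simp add: r_def)
  have r2: "1 \<le> 81 * r\<^sup>2" using power_mono[OF r, of 2] by (simp add: power2_eq_square)
  have r4: "1 \<le> 81 * r ^ 4" using power_mono[OF r, of 4] by (simp add: eval_nat_numeral)
  have n: "(norm w)\<^sup>2 = r\<^sup>2 * ((Re \<omega>)\<^sup>2 + (Im \<omega>)\<^sup>2)"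
    by (simp add: w norm_mult power_mult_distrib r_def cmod_power2 mult.commute)
  have "inner z w = r\<^sup>2 * Re \<omega>"
    by (simp add: w inner_complex_def r_def cmod_power2) (simp add: algebra_simps power2_eq_square)
  then have i: "(inner z w)\<^sup>2 = r ^ 4 * (Re \<omega>)\<^sup>2" by (simp add: power_mult_distrib)
  have "(Re \<omega>)\<^sup>2 / s ^ 3 * 1 \<le> (Re \<omega>)\<^sup>2 / s ^ 3 * (81 * r ^ 4)" "(Im \<omega>)\<^sup>2 / s * 1 \<le> (Im \<omega>)\<^sup>2 / s * (81 * r\<^sup>2)"
    using s r2 r4 by (intro mult_left_mono; simp)+
  moreover have "0 \<le> 81 * (r\<^sup>2 * (Re \<omega>)\<^sup>2 / s)" using s by simp
  moreover have "81 * inner w (hyp_hess z w) = 81 * (r\<^sup>2 * (Re \<omega>)\<^sup>2 / s) + (Im \<omega>)\<^sup>2 / s * (81 * r\<^sup>2) + (Re \<omega>)\<^sup>2 / s ^ 3 * (81 * r ^ 4)"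
    unfolding hyp_hess_form n i s_def[symmetric] by (simp add: field_simps add_divide_distrib)
  ultimately show ?thesis unfolding \<omega>_def[symmetric] s_def[symmetric] by linarith
qed

section \<open>Extension to the disc\<close>

context zygmund_primitives
begin

text \<open>The cutoff \<open>cut 3\<close> is \<open>C\<^sup>2\<close>, equals \<open>1\<close> on the boundary \<open>Re \<zeta> = 0\<close> and vanishes for \<open>Re \<zeta> \<le> - 1\<close>; the extension built from it
is zero near the centre of the disc, where the logarithmic coordinate is singular.\<close>

definition cut :: "nat \<Rightarrow> complex \<Rightarrow> real" where "cut n \<zeta> = max 0 (1 + Re \<zeta>) ^ n"

lemma cut_has_derivative:
  "(cut (Suc (Suc n)) has_derivative (\<lambda>w. real (Suc (Suc n)) * cut (Suc n) \<zeta> * Re w)) (at \<zeta>)"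
proof -
  have "((\<lambda>\<zeta>. 1 + Re \<zeta>) has_derivative Re) (at \<zeta>)" by (auto intro!: derivative_eq_intros)
  from DERIV_compose_FDERIV[OF max_power_has_derivative this, of n]
  show ?thesis unfolding cut_def[abs_def] by (rule has_derivative_eq_rhs) (simp add: fun_eq_iff)
qed

lemma cut_bounds: "0 \<le> cut n \<zeta>" "Re \<zeta> < 0 \<Longrightarrow> cut n \<zeta> \<le> 1"
  by (auto simp: cut_def intro!: power_le_one)

lemma cut_eq_0: "Re \<zeta> \<le> -1 \<Longrightarrow> n > 0 \<Longrightarrow> cut n \<zeta> = 0"
  by (simp add: cut_def)

definition F :: "complex \<Rightarrow> real" where "F \<zeta> = cut 3 \<zeta> * H \<zeta>"
definition F\<^sub>r :: "complex \<Rightarrow> real" where "F\<^sub>r \<zeta> = 3 * cut 2 \<zeta> * H \<zeta> + cut 3 \<zeta> * H\<^sub>r \<zeta>"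
definition F\<^sub>t :: "complex \<Rightarrow> real" where "F\<^sub>t \<zeta> = cut 3 \<zeta> * H\<^sub>t \<zeta>"
definition F\<^sub>r\<^sub>r :: "complex \<Rightarrow> real" where
  "F\<^sub>r\<^sub>r \<zeta> = 6 * cut 1 \<zeta> * H \<zeta> + 6 * cut 2 \<zeta> * H\<^sub>r \<zeta> + cut 3 \<zeta> * H\<^sub>r\<^sub>r \<zeta>"
definition F\<^sub>r\<^sub>t :: "complex \<Rightarrow> real" where "F\<^sub>r\<^sub>t \<zeta> = 3 * cut 2 \<zeta> * H\<^sub>t \<zeta> + cut 3 \<zeta> * H\<^sub>r\<^sub>t \<zeta>"
definition F\<^sub>t\<^sub>t :: "complex \<Rightarrow> real" where "F\<^sub>t\<^sub>t \<zeta> = cut 3 \<zeta> * H\<^sub>t\<^sub>t \<zeta>"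

lemma F_has_derivative:
  assumes "Re \<zeta> < 0"
  shows "(F has_derivative (\<lambda>w. F\<^sub>r \<zeta> * Re w + F\<^sub>t \<zeta> * Im w)) (at \<zeta>)"
    "(F\<^sub>r has_derivative (\<lambda>w. F\<^sub>r\<^sub>r \<zeta> * Re w + F\<^sub>r\<^sub>t \<zeta> * Im w)) (at \<zeta>)"
    "(F\<^sub>t has_derivative (\<lambda>w. F\<^sub>r\<^sub>t \<zeta> * Re w + F\<^sub>t\<^sub>t \<zeta> * Im w)) (at \<zeta>)"
proof -
  have c: "(cut 3 has_derivative (\<lambda>w. 3 * cut 2 \<zeta> * Re w)) (at \<zeta>)"
    "(cut 2 has_derivative (\<lambda>w. 2 * cut 1 \<zeta> * Re w)) (at \<zeta>)"
    using cut_has_derivative[of 1 \<zeta>] cut_has_derivative[of 0 \<zeta>] by (simp_all add: numeral_2_eq_2 numeral_3_eq_3)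
  show "(F has_derivative (\<lambda>w. F\<^sub>r \<zeta> * Re w + F\<^sub>t \<zeta> * Im w)) (at \<zeta>)"
    "(F\<^sub>r has_derivative (\<lambda>w. F\<^sub>r\<^sub>r \<zeta> * Re w + F\<^sub>r\<^sub>t \<zeta> * Im w)) (at \<zeta>)"
    "(F\<^sub>t has_derivative (\<lambda>w. F\<^sub>r\<^sub>t \<zeta> * Re w + F\<^sub>t\<^sub>t \<zeta> * Im w)) (at \<zeta>)"
    unfolding F_def[abs_def] F\<^sub>r_def[abs_def] F\<^sub>t_def[abs_def] F\<^sub>r\<^sub>r_def F\<^sub>r\<^sub>t_def F\<^sub>t\<^sub>t_def
    by (rule has_derivative_eq_rhs, (rule c H_has_derivative assms derivative_intros)+,
        simp add: fun_eq_iff algebra_simps)+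
qed

lemma periodic_F:
  "F (\<zeta> + 2 * of_real pi * \<i>) = F \<zeta>" "F\<^sub>r (\<zeta> + 2 * of_real pi * \<i>) = F\<^sub>r \<zeta>" "F\<^sub>t (\<zeta> + 2 * of_real pi * \<i>) = F\<^sub>t \<zeta>"
  "F\<^sub>r\<^sub>r (\<zeta> + 2 * of_real pi * \<i>) = F\<^sub>r\<^sub>r \<zeta>" "F\<^sub>r\<^sub>t (\<zeta> + 2 * of_real pi * \<i>) = F\<^sub>r\<^sub>t \<zeta>"
  "F\<^sub>t\<^sub>t (\<zeta> + 2 * of_real pi * \<i>) = F\<^sub>t\<^sub>t \<zeta>"
  by (simp_all add: F_def F\<^sub>r_def F\<^sub>t_def F\<^sub>r\<^sub>r_def F\<^sub>r\<^sub>t_def F\<^sub>t\<^sub>t_def cut_def H_def H\<^sub>r_def H\<^sub>t_def H\<^sub>r\<^sub>r_def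
      H\<^sub>r\<^sub>t_def H\<^sub>t\<^sub>t_def inv_depth_def depth_def periodic_differences)

lemma isCont_F:
  assumes "Re \<zeta> < 0"
  shows "isCont F\<^sub>r\<^sub>r \<zeta>" "isCont F\<^sub>r\<^sub>t \<zeta>" "isCont F\<^sub>t\<^sub>t \<zeta>"
proof -
  have cH: "isCont H \<zeta>" "isCont H\<^sub>r \<zeta>" "isCont H\<^sub>t \<zeta>" "isCont inv_depth \<zeta>" "isCont depth \<zeta>"
    using H_has_derivative[OF assms] inv_depth_derivative[OF assms] depth_derivative[OF assms]
    by (auto intro: has_derivative_continuous)
  have cE: "isCont (\<lambda>\<zeta>. E (Im \<zeta>) (depth \<zeta>)) \<zeta>" "isCont (\<lambda>\<zeta>. E\<^sub>e (Im \<zeta>) (depth \<zeta>)) \<zeta>" "isCont (\<lambda>\<zeta>. E\<^sub>t (Im \<zeta>) (depth \<zeta>)) \<zeta>"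
    using differences_have_derivative[OF assms] by (auto intro: has_derivative_continuous)
  have cq: "isCont (\<lambda>\<zeta>. q (f \<zeta>)) \<zeta>" if "isCont f \<zeta>" for f :: "complex \<Rightarrow> real"
    using cont that by (intro isCont_o2[of \<zeta> f q]) (auto simp: continuous_on_eq_continuous_at)
  have cq3: "isCont (\<lambda>\<zeta>. q (Im \<zeta> + depth \<zeta>)) \<zeta>" "isCont (\<lambda>\<zeta>. q (Im \<zeta> - depth \<zeta>)) \<zeta>" "isCont (\<lambda>\<zeta>. q (Im \<zeta>)) \<zeta>"
    by (rule cq, intro continuous_intros cH linear_continuous_at bounded_linear_Im bounded_linear_Re)+
  have cc: "isCont (cut n) \<zeta>" for n unfolding cut_def[abs_def]
    by (intro continuous_intros linear_continuous_at bounded_linear_Re)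
  have cH2: "isCont H\<^sub>r\<^sub>r \<zeta>" "isCont H\<^sub>r\<^sub>t \<zeta>" "isCont H\<^sub>t\<^sub>t \<zeta>"
    unfolding H\<^sub>r\<^sub>r_def[abs_def] H\<^sub>r\<^sub>t_def[abs_def] H\<^sub>t\<^sub>t_def[abs_def] E\<^sub>e\<^sub>e_def E\<^sub>e\<^sub>t_def E\<^sub>t\<^sub>t_def
    by (intro continuous_intros cH cE cq3)+
  show "isCont F\<^sub>r\<^sub>r \<zeta>" "isCont F\<^sub>r\<^sub>t \<zeta>" "isCont F\<^sub>t\<^sub>t \<zeta>"
    unfolding F\<^sub>r\<^sub>r_def[abs_def] F\<^sub>r\<^sub>t_def[abs_def] F\<^sub>t\<^sub>t_def[abs_def]
    by (intro continuous_intros cH cH2 cc)+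
qed

lemma F_eq_0:
  assumes "Re \<zeta> \<le> -1"
  shows "F \<zeta> = 0" "F\<^sub>r \<zeta> = 0" "F\<^sub>t \<zeta> = 0" "F\<^sub>r\<^sub>r \<zeta> = 0" "F\<^sub>r\<^sub>t \<zeta> = 0" "F\<^sub>t\<^sub>t \<zeta> = 0"
  using cut_eq_0[OF assms] by (simp_all add: F_def F\<^sub>r_def F\<^sub>t_def F\<^sub>r\<^sub>r_def F\<^sub>r\<^sub>t_def F\<^sub>t\<^sub>t_def)

text \<open>The largest coefficient that arises in the bounds below is \<open>22\<close>.\<close>

definition L :: real where "L = 40 * (C + M)"

lemma F_bounds:
  assumes "Re \<zeta> < 0" "-1 \<le> Re \<zeta>"
  shows "1 \<le> inv_depth \<zeta>" "\<bar>F\<^sub>r \<zeta>\<bar> \<le> L * inv_depth \<zeta>" "\<bar>F\<^sub>t \<zeta>\<bar> \<le> L * inv_depth \<zeta>"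
    "\<bar>F\<^sub>r\<^sub>r \<zeta>\<bar> \<le> L * inv_depth \<zeta> ^ 3" "\<bar>F\<^sub>r\<^sub>t \<zeta>\<bar> \<le> L * inv_depth \<zeta> ^ 2" "\<bar>F\<^sub>t\<^sub>t \<zeta>\<bar> \<le> L * inv_depth \<zeta>"
proof -
  define y where "y = inv_depth \<zeta>"
  have e: "0 < depth \<zeta>" "depth \<zeta> \<le> 1" using assms by (auto simp: depth_def)
  then have y: "1 \<le> y" by (simp add: y_def inv_depth_def)
  then show "1 \<le> inv_depth \<zeta>" by (simp add: y_def)
  have yy: "1 \<le> y ^ 3" "y \<le> y ^ 3" "y \<le> y ^ 2"
    using y power_increasing[of 1 3 y] power_increasing[of 1 2 y] by (simp_all add: one_le_power)
  note b = H_derivative_bounds[OF assms(1), folded y_def]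
  note cb = cut_bounds(1) cut_bounds(2)[OF assms(1)]
  have pos: "0 \<le> C" "0 \<le> M" by (rule C_nonneg M_nonneg)+
  have scale: "\<bar>cut n \<zeta> * h\<bar> \<le> B" if "\<bar>h\<bar> \<le> B" for n h B
    using mult_mono[OF cb(2) that] cb(1)[of n \<zeta>] by (simp add: abs_mult)
  have up: "\<bar>h\<bar> \<le> B * y'" if "\<bar>h\<bar> \<le> B * x" "0 \<le> B" "x \<le> y'" for h B x y' :: real
    using mult_left_mono[OF that(3,2)] that(1) by simp
  have "\<bar>H \<zeta>\<bar> \<le> M + C * depth \<zeta>" using H_bound[OF assms(1)] bound[of "Im \<zeta>"] by linarith
  also have "\<dots> \<le> M + C * 1" using e pos by (intro add_left_mono mult_left_mono) auto
  finally have H0: "\<bar>H \<zeta>\<bar> \<le> (M + C) * 1" by simp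
  have H1: "\<bar>H \<zeta>\<bar> \<le> (M + C) * y" and H3: "\<bar>H \<zeta>\<bar> \<le> (M + C) * y ^ 3"
    by (rule up[OF H0]; use pos y yy in simp)+
  have L: "x \<le> L * t" if "x \<le> (40 * (C + M)) * t" for x t using that by (simp add: L_def)
  have Cy: "0 \<le> C * y" "0 \<le> M * y" "0 \<le> C * y ^ 2" "0 \<le> M * y ^ 2" "0 \<le> C * y ^ 3" "0 \<le> M * y ^ 3"
    using pos y by auto
  have "\<bar>F\<^sub>r \<zeta>\<bar> \<le> 3 * \<bar>cut 2 \<zeta> * H \<zeta>\<bar> + \<bar>cut 3 \<zeta> * H\<^sub>r \<zeta>\<bar>" unfolding F\<^sub>r_def by (simp add: mult.assoc)
  also have "\<dots> \<le> 3 * ((M + C) * y) + 2 * C * y" by (intro add_mono mult_left_mono scale b H1) simp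
  also have "\<dots> \<le> L * y" using Cy by (intro L) (simp add: algebra_simps)
  finally show "\<bar>F\<^sub>r \<zeta>\<bar> \<le> L * inv_depth \<zeta>" by (simp add: y_def)
  have "\<bar>F\<^sub>t \<zeta>\<bar> \<le> 2 * M * y" unfolding F\<^sub>t_def by (intro scale b)
  also have "\<dots> \<le> L * y" using Cy by (intro L) (simp add: algebra_simps)
  finally show "\<bar>F\<^sub>t \<zeta>\<bar> \<le> L * inv_depth \<zeta>" by (simp add: y_def)
  have "\<bar>F\<^sub>r\<^sub>r \<zeta>\<bar> \<le> 6 * \<bar>cut 1 \<zeta> * H \<zeta>\<bar> + 6 * \<bar>cut 2 \<zeta> * H\<^sub>r \<zeta>\<bar> + \<bar>cut 3 \<zeta> * H\<^sub>r\<^sub>r \<zeta>\<bar>"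
    unfolding F\<^sub>r\<^sub>r_def by (simp add: mult.assoc)
  also have "\<dots> \<le> 6 * ((M + C) * y ^ 3) + 6 * (2 * C * y ^ 3) + 4 * C * y ^ 3"
    by (intro add_mono mult_left_mono scale b H3 up[OF b(1)]) (use pos yy in auto)
  also have "\<dots> \<le> L * y ^ 3" using Cy by (intro L) (simp add: algebra_simps)
  finally show "\<bar>F\<^sub>r\<^sub>r \<zeta>\<bar> \<le> L * inv_depth \<zeta> ^ 3" by (simp add: y_def)
  have "\<bar>F\<^sub>r\<^sub>t \<zeta>\<bar> \<le> 3 * \<bar>cut 2 \<zeta> * H\<^sub>t \<zeta>\<bar> + \<bar>cut 3 \<zeta> * H\<^sub>r\<^sub>t \<zeta>\<bar>" unfolding F\<^sub>r\<^sub>t_def by (simp add: mult.assoc)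
  also have "\<dots> \<le> 3 * (2 * M * y ^ 2) + C * y ^ 2"
    by (intro add_mono mult_left_mono scale b up[OF b(2)]) (use pos yy in auto)
  also have "\<dots> \<le> L * y ^ 2" using Cy by (intro L) (simp add: algebra_simps)
  finally show "\<bar>F\<^sub>r\<^sub>t \<zeta>\<bar> \<le> L * inv_depth \<zeta> ^ 2" by (simp add: y_def)
  have "\<bar>F\<^sub>t\<^sub>t \<zeta>\<bar> \<le> C * y" unfolding F\<^sub>t\<^sub>t_def by (intro scale b)
  also have "\<dots> \<le> L * y" using Cy by (intro L) (simp add: algebra_simps)
  finally show "\<bar>F\<^sub>t\<^sub>t \<zeta>\<bar> \<le> L * inv_depth \<zeta>" by (simp add: y_def)
qed

text \<open>Gradients are complex numbers, in agreement with the inner product of the plane. Under \<open>\<zeta> = Ln z\<close> a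
gradient is divided by \<open>cnj z\<close>, since \<open>inner (a / cnj z) w = inner a (w / z)\<close>. At \<open>z = 0\<close> the convention
\<open>x / 0 = 0\<close> gives \<open>grad_extension\<close> and \<open>hess_extension\<close> the correct value.\<close>

definition grad_F :: "complex \<Rightarrow> complex" where
  "grad_F \<zeta> = of_real (F\<^sub>r \<zeta>) + \<i> * of_real (F\<^sub>t \<zeta>)"
definition hess_F :: "complex \<Rightarrow> complex \<Rightarrow> complex" where
  "hess_F \<zeta> w = of_real (F\<^sub>r\<^sub>r \<zeta> * Re w + F\<^sub>r\<^sub>t \<zeta> * Im w) + \<i> * of_real (F\<^sub>r\<^sub>t \<zeta> * Re w + F\<^sub>t\<^sub>t \<zeta> * Im w)"

definition extension :: "complex \<Rightarrow> real" where "extension z = (if z = 0 then 0 else F (Ln z))"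
definition grad_extension :: "complex \<Rightarrow> complex" where "grad_extension z = grad_F (Ln z) / cnj z"
definition hess_extension :: "complex \<Rightarrow> complex \<Rightarrow> complex" where
  "hess_extension z w = hess_F (Ln z) (w / z) / cnj z - grad_F (Ln z) * cnj w / (cnj z)\<^sup>2"

lemma extension_eq_0:
  assumes "z \<in> ball 0 (exp (-1))"
  shows "extension z = 0" "grad_extension z = 0" "hess_extension z w = 0"
proof -
  have "extension z = 0 \<and> grad_extension z = 0 \<and> hess_extension z w = 0"
  proof (cases "z = 0")
    case True
    then show ?thesis by (simp add: extension_def grad_extension_def hess_extension_def)
  next
    case False
    then have "ln (norm z) < -1" using assms by (metis dist_0_norm ln_exp ln_less_cancel_iff mem_ball zero_less_norm_iff exp_gt_zero)
    then have "Re (Ln z) \<le> -1" using False by simp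
    from F_eq_0[OF this] show ?thesis by (simp add: extension_def grad_extension_def hess_extension_def grad_F_def hess_F_def)
  qed
  then show "extension z = 0" "grad_extension z = 0" "hess_extension z w = 0" by auto
qed

lemma extension_derivatives:
  assumes z: "z \<in> ball 0 1"
  shows "(extension has_derivative inner (grad_extension z)) (at z)" "(grad_extension has_derivative hess_extension z) (at z)"
    "isCont (\<lambda>z. hess_extension z w) z"
proof -
  have "(extension has_derivative inner (grad_extension z)) (at z) \<and> (grad_extension has_derivative hess_extension z) (at z) \<and> isCont (\<lambda>z. hess_extension z w) z"
  proof (cases "z = 0")
    case True
    have z0: "z \<in> ball 0 (exp (-1))" "open (ball (0::complex) (exp (-1)))" using True by auto
    have "(extension has_derivative (\<lambda>w. 0)) (at z)"
      by (rule has_derivative_transform_within_open[OF has_derivative_const z0(2,1), of 0]) (simp add: extension_eq_0)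
    moreover have "(grad_extension has_derivative (\<lambda>w. 0)) (at z)"
      by (rule has_derivative_transform_within_open[OF has_derivative_const z0(2,1), of 0]) (simp add: extension_eq_0)
    moreover have "isCont (\<lambda>z. hess_extension z w) z"
    proof -
      have "\<forall>\<^sub>F x in nhds z. hess_extension x w = 0"
        unfolding eventually_nhds using z0 extension_eq_0(3) by blast
      then show ?thesis using isCont_cong[of "\<lambda>z. hess_extension z w" "\<lambda>z. 0" z] by simp
    qed
    moreover have "inner (grad_extension z) = (\<lambda>w. 0)" "hess_extension z = (\<lambda>w. 0)" using extension_eq_0[OF z0(1)] by auto
    ultimately show ?thesis by simp
  next
    case False
    have neg: "Re (Ln z) < 0" using False z by simp
    note d = F_has_derivative[OF neg]
    have dF: "(F has_derivative inner (grad_F (Ln z))) (at (Ln z))"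
      using d(1) by (rule has_derivative_eq_rhs) (simp add: fun_eq_iff inner_complex_def grad_F_def)
    have dg: "(grad_F has_derivative hess_F (Ln z)) (at (Ln z))"
      unfolding grad_F_def[abs_def]
      by (rule has_derivative_eq_rhs, (rule d derivative_intros)+) (simp add: fun_eq_iff hess_F_def)
    have perg: "grad_F (\<zeta> + 2 * of_real pi * \<i>) = grad_F \<zeta>" for \<zeta> by (simp only: grad_F_def periodic_F)
    have "((\<lambda>z. F (Ln z)) has_derivative inner (grad_extension z)) (at z)"
      by (rule has_derivative_eq_rhs[OF periodic_Ln_has_derivative[OF periodic_F(1) False dF]])
        (simp add: fun_eq_iff grad_extension_def inner_commute[of "grad_F (Ln z)"] inner_commute[of "grad_F (Ln z) / cnj z"] inner_divide_cnj)
    then have 1: "(extension has_derivative inner (grad_extension z)) (at z)"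
      by (rule has_derivative_transform_within_open[of _ _ _ _ "- {0}"]) (use False in \<open>auto simp: extension_def\<close>)
    note dL = periodic_Ln_has_derivative[OF perg False dg]
    have 2: "(grad_extension has_derivative hess_extension z) (at z)"
      unfolding grad_extension_def[abs_def]
      by (rule has_derivative_eq_rhs, (rule dL derivative_intros)+)
        (use False in \<open>auto simp: fun_eq_iff hess_extension_def field_simps power2_eq_square\<close>)
    have cg: "isCont (\<lambda>z. grad_F (Ln z)) z" by (rule has_derivative_continuous[OF dL])
    have c2: "isCont (\<lambda>z. F\<^sub>r\<^sub>r (Ln z)) z" "isCont (\<lambda>z. F\<^sub>r\<^sub>t (Ln z)) z" "isCont (\<lambda>z. F\<^sub>t\<^sub>t (Ln z)) z"
      by (rule periodic_Ln_isCont; use periodic_F False isCont_F[OF neg] in simp)+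
    have 3: "isCont (\<lambda>z. hess_extension z w) z"
      unfolding hess_extension_def hess_F_def using False by (intro continuous_intros cg c2) auto
    show ?thesis using 1 2 3 by blast
  qed
  then show "(extension has_derivative inner (grad_extension z)) (at z)" "(grad_extension has_derivative hess_extension z) (at z)"
    "isCont (\<lambda>z. hess_extension z w) z" by auto
qed

text \<open>With \<open>w / z = a + \<i> b\<close>, the second derivatives of \<open>F\<close> give terms of order \<open>y\<^sup>3 a\<^sup>2\<close>, \<open>y\<^sup>2 a b\<close> and \<open>y b\<^sup>2\<close> for
\<open>y = inv_depth \<zeta>\<close>, and the curvature of the logarithmic coordinate adds first derivatives of order \<open>y\<close>. All are dominated by
\<open>y\<^sup>3 a\<^sup>2 + y b\<^sup>2\<close>, and \<open>y \<le> 2 / lapse z\<close> turns this into the form of \<open>hyp_hess\<close>. The constant \<open>2592\<close> is \<open>4 * 8 * 81\<close>.\<close>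

lemma hess_extension_bound:
  assumes z: "z \<in> ball 0 1"
  shows "\<bar>inner w (hess_extension z w)\<bar> \<le> (2592 * L) * inner w (hyp_hess z w)"
proof (cases "z \<in> ball 0 (exp (-1))")
  case True
  have "0 \<le> L" using C_nonneg M_nonneg by (simp add: L_def)
  moreover have "0 \<le> inner w (hyp_hess z w)" using hyp_hess_ge[of z w] z by (smt (verit) mem_ball_0 zero_le_power2)
  ultimately show ?thesis using extension_eq_0(3)[OF True] by simp
next
  case False
  then have r: "exp (-1) \<le> norm z" "norm z < 1" using z by auto
  then have z0: "z \<noteq> 0" by auto
  define \<zeta> where "\<zeta> = Ln z"
  have "ln (exp (-1)) \<le> ln (norm z)" using r z0 by (subst ln_le_cancel_iff) auto
  then have neg: "Re \<zeta> < 0" "-1 \<le> Re \<zeta>" using z0 r by (simp_all add: \<zeta>_def)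
  define \<omega> where "\<omega> = w / z"
  define y where "y = inv_depth \<zeta>"
  define a where "a = Re \<omega>"
  define b where "b = Im \<omega>"
  note F = F_bounds[OF neg, folded y_def]
  have L: "0 \<le> L" using C_nonneg M_nonneg by (simp add: L_def)
  have "hess_extension z w = (hess_F \<zeta> \<omega> - grad_F \<zeta> * cnj \<omega>) / cnj z"
    using z0 by (simp add: hess_extension_def \<zeta>_def \<omega>_def power2_eq_square diff_divide_distrib)
  then have "inner w (hess_extension z w) = inner \<omega> (hess_F \<zeta> \<omega> - grad_F \<zeta> * cnj \<omega>)"
    by (simp only: inner_divide_cnj \<omega>_def)
  also have "\<dots> = F\<^sub>r\<^sub>r \<zeta> * a\<^sup>2 + 2 * (F\<^sub>r\<^sub>t \<zeta> * (a * b)) + F\<^sub>t\<^sub>t \<zeta> * b\<^sup>2 - F\<^sub>r \<zeta> * (a\<^sup>2 - b\<^sup>2) - 2 * (F\<^sub>t \<zeta> * (a * b))"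
    by (simp add: hess_F_def grad_F_def inner_complex_def a_def b_def algebra_simps power2_eq_square)
  finally have "\<bar>inner w (hess_extension z w)\<bar> \<le> \<bar>F\<^sub>r\<^sub>r \<zeta> * a\<^sup>2\<bar> + 2 * \<bar>F\<^sub>r\<^sub>t \<zeta> * (a * b)\<bar> + \<bar>F\<^sub>t\<^sub>t \<zeta> * b\<^sup>2\<bar>
      + \<bar>F\<^sub>r \<zeta> * (a\<^sup>2 - b\<^sup>2)\<bar> + 2 * \<bar>F\<^sub>t \<zeta> * (a * b)\<bar>" by linarith
  also have "\<dots> = \<bar>F\<^sub>r\<^sub>r \<zeta>\<bar> * a\<^sup>2 + 2 * (\<bar>F\<^sub>r\<^sub>t \<zeta>\<bar> * \<bar>a * b\<bar>) + \<bar>F\<^sub>t\<^sub>t \<zeta>\<bar> * b\<^sup>2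
      + \<bar>F\<^sub>r \<zeta>\<bar> * \<bar>a\<^sup>2 - b\<^sup>2\<bar> + 2 * (\<bar>F\<^sub>t \<zeta>\<bar> * \<bar>a * b\<bar>)" by (simp add: abs_mult)
  also have "\<dots> \<le> (L * y ^ 3) * a\<^sup>2 + 2 * ((L * y\<^sup>2) * \<bar>a * b\<bar>) + (L * y) * b\<^sup>2
      + (L * y) * (a\<^sup>2 + b\<^sup>2) + 2 * ((L * y) * \<bar>a * b\<bar>)"
    using F L by (intro add_mono mult_mono mult_left_mono F) (auto simp: abs_le_iff)
  also have "\<dots> = L * (y ^ 3 * a\<^sup>2 + 2 * y\<^sup>2 * \<bar>a * b\<bar> + y * b\<^sup>2 + y * (a\<^sup>2 + b\<^sup>2) + 2 * y * \<bar>a * b\<bar>)"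
    by (simp add: algebra_simps)
  also have "\<dots> \<le> L * (4 * (y ^ 3 * a\<^sup>2 + y * b\<^sup>2))"
  proof (rule mult_left_mono[OF _ L])
    have y: "1 \<le> y" by (rule F(1))
    have "0 \<le> y * (y * \<bar>a\<bar> - \<bar>b\<bar>)\<^sup>2" using y by simp
    then have 1: "2 * y\<^sup>2 * \<bar>a * b\<bar> \<le> y ^ 3 * a\<^sup>2 + y * b\<^sup>2"
      by (simp add: power2_diff power_mult_distrib abs_mult algebra_simps eval_nat_numeral)
    have "0 \<le> y * (\<bar>a\<bar> - \<bar>b\<bar>)\<^sup>2" using y by simp
    then have 2: "2 * y * \<bar>a * b\<bar> \<le> y * a\<^sup>2 + y * b\<^sup>2"
      by (simp add: power2_diff abs_mult algebra_simps)
    have "y * a\<^sup>2 \<le> y ^ 3 * a\<^sup>2" using y power_increasing[of 1 3 y] by (intro mult_right_mono) auto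
    then show "y ^ 3 * a\<^sup>2 + 2 * y\<^sup>2 * \<bar>a * b\<bar> + y * b\<^sup>2 + y * (a\<^sup>2 + b\<^sup>2) + 2 * y * \<bar>a * b\<bar>
      \<le> 4 * (y ^ 3 * a\<^sup>2 + y * b\<^sup>2)" using 1 2 by (simp add: algebra_simps)
  qed
  also have "\<dots> \<le> L * (4 * ((2 / lapse z) ^ 3 * a\<^sup>2 + (2 / lapse z) ^ 1 * b\<^sup>2))"
  proof -
    have s: "0 < lapse z" using lapse_pos r by simp
    have d: "0 < depth \<zeta>" using depth_pos[OF neg(1)] .
    have "lapse z \<le> 2 * depth \<zeta>" using lapse_le_log[OF z0 r(2)] z0 by (simp add: \<zeta>_def depth_def)
    then have "y \<le> 2 / lapse z" using s d by (simp add: y_def inv_depth_def field_simps)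
    moreover have "0 \<le> y" using F(1) by simp
    ultimately have "y ^ 3 \<le> (2 / lapse z) ^ 3" "y \<le> (2 / lapse z) ^ 1" by (auto intro: power_mono)
    then show ?thesis using L by (intro mult_left_mono add_mono mult_right_mono) auto
  qed
  also have "\<dots> \<le> L * (32 * (a\<^sup>2 / lapse z ^ 3 + b\<^sup>2 / lapse z))"
    using L lapse_pos[OF r(2)] by (intro mult_left_mono) (auto simp: field_simps power_divide)
  also have "\<dots> \<le> L * (32 * (81 * inner w (hyp_hess z w)))"
    using hyp_hess_log_coordinates[OF r, of w] L by (intro mult_left_mono) (auto simp: a_def b_def \<omega>_def)
  finally show ?thesis by (simp add: mult_ac)
qed

end

section \<open>The equivalence\<close>

lemma continuous_has_antiderivative:
  fixes k :: "real \<Rightarrow> real"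
  assumes "continuous_on UNIV k"
  obtains K where "\<And>t. (K has_real_derivative k t) (at t)"
proof -
  have "\<exists>K. \<forall>t::real. - \<infinity> < ereal t \<longrightarrow> ereal t < \<infinity> \<longrightarrow> (K has_vector_derivative k t) (at t)"
    using assms by (intro einterval_antiderivative) (auto simp: continuous_on_eq_continuous_at)
  then show ?thesis using that by (auto simp: has_real_derivative_iff_has_vector_derivative)
qed

text \<open>By \<open>H_bound\<close> the smoothing differs from \<open>\<phi> (sgn z)\<close> by at most \<open>C\<close> times the scale, which tends to zero at the
boundary.\<close>

lemma (in zygmund_primitives) extension_tendsto_boundary:
  assumes \<phi>: "continuous_on (sphere 0 1) \<phi>" and q: "\<And>t. q t = \<phi> (cis t)" and z0: "z0 \<in> sphere 0 1"
  shows "(extension \<longlongrightarrow> \<phi> z0) (at z0 within ball 0 1)"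
proof -
  let ?F = "at z0 within ball (0::complex) 1"
  have n0: "norm z0 = 1" using z0 by simp
  have lim_id: "((\<lambda>z. z) \<longlongrightarrow> z0) ?F" by (rule tendsto_ident_at)
  have lim_ln: "((\<lambda>z. ln (norm z)) \<longlongrightarrow> 0) ?F"
    using tendsto_ln[OF tendsto_norm[OF lim_id]] n0 by simp
  have ev: "\<forall>\<^sub>F z in ?F. z \<in> ball 0 1 \<and> z \<noteq> 0"
  proof -
    have "\<forall>\<^sub>F z in ?F. z \<noteq> 0" using n0 by (intro tendsto_imp_eventually_ne[OF lim_id]) auto
    moreover have "\<forall>\<^sub>F z in ?F. z \<in> ball 0 1" by (auto simp: eventually_at_filter)
    ultimately show ?thesis by eventually_elim auto
  qed
  have lim_cut: "((\<lambda>z. max 0 (1 + ln (norm z)) ^ 3) \<longlongrightarrow> max 0 (1 + 0) ^ 3) ?F"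
    by (intro tendsto_intros lim_ln)
  have "((\<lambda>z. \<phi> (sgn z)) \<longlongrightarrow> \<phi> (sgn z0)) ?F"
  proof (rule continuous_on_tendsto_compose[OF \<phi>])
    show "((\<lambda>z. sgn z) \<longlongrightarrow> sgn z0) ?F" using n0 by (intro tendsto_intros) auto
    show "sgn z0 \<in> sphere 0 1" using n0 by (auto simp: norm_sgn)
    show "\<forall>\<^sub>F z in ?F. sgn z \<in> sphere 0 1" using ev by eventually_elim (simp add: norm_sgn)
  qed
  then have lim_phi: "((\<lambda>z. \<phi> (sgn z)) \<longlongrightarrow> \<phi> z0) ?F" using n0 by (simp add: sgn_div_norm)
  have lim_main: "((\<lambda>z. max 0 (1 + ln (norm z)) ^ 3 * \<phi> (sgn z)) \<longlongrightarrow> max 0 (1 + 0) ^ 3 * \<phi> z0) ?F"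
    by (intro tendsto_mult lim_cut lim_phi)
  have lim_err: "((\<lambda>z. C * sqrt (- ln (norm z))) \<longlongrightarrow> C * sqrt (- 0)) ?F"
    by (intro tendsto_intros lim_ln)
  have err: "norm (extension z - max 0 (1 + ln (norm z)) ^ 3 * \<phi> (sgn z)) \<le> C * sqrt (- ln (norm z))"
    if z: "z \<in> ball 0 1 \<and> z \<noteq> 0" for z
  proof -
    have neg: "Re (Ln z) < 0" using z by simp
    have "z = of_real (norm z) * cis (Im (Ln z))"
      using exp_eq_polar[of "Ln z"] z by simp
    then have "sgn z = cis (Im (Ln z))" using z
      by (metis sgn_mult sgn_of_real sgn_cis mult_1 of_real_1 sgn_pos zero_less_norm_iff norm_cis sgn_div_norm inverse_1 scaleR_one)
    then have "q (Im (Ln z)) = \<phi> (sgn z)" by (simp add: q)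
    moreover have "extension z = cut 3 (Ln z) * H (Ln z)" using z by (simp add: extension_def F_def)
    moreover have "cut 3 (Ln z) = max 0 (1 + ln (norm z)) ^ 3" using z by (simp add: cut_def)
    ultimately have "norm (extension z - max 0 (1 + ln (norm z)) ^ 3 * \<phi> (sgn z)) = cut 3 (Ln z) * \<bar>H (Ln z) - q (Im (Ln z))\<bar>"
      using cut_bounds(1)[of 3 "Ln z"] by (simp add: abs_mult flip: right_diff_distrib)
    also have "\<dots> \<le> 1 * (C * depth (Ln z))"
      using cut_bounds(1)[of 3 "Ln z"] cut_bounds(2)[OF neg, of 3] neg by (intro mult_mono H_bound) auto
    also have "\<dots> = C * sqrt (- ln (norm z))" using z by (simp add: depth_def)
    finally show ?thesis .
  qed
  have "((\<lambda>z. extension z - max 0 (1 + ln (norm z)) ^ 3 * \<phi> (sgn z)) \<longlongrightarrow> 0) ?F"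
  proof (rule Lim_null_comparison)
    show "\<forall>\<^sub>F z in ?F. norm (extension z - max 0 (1 + ln (norm z)) ^ 3 * \<phi> (sgn z)) \<le> C * sqrt (- ln (norm z))"
      using ev by eventually_elim (rule err)
  qed (use lim_err in simp)
  from tendsto_add[OF this lim_main] show ?thesis by simp
qed

text \<open>Adding \<open>(K + 1) (- lapse)\<close> to the extension shifts its Hessian, which lies between \<open>- K\<close> and \<open>K\<close> times \<open>hyp_hess\<close>, to
one between \<open>1\<close> and \<open>2 K + 1\<close> times \<open>hyp_hess\<close>, and leaves the boundary values unchanged.\<close>

lemma curvature_bounded_below_if_zygmund:
  assumes \<phi>: "continuous_on (sphere 0 1) \<phi>" and "zygmund \<phi>"
  shows "\<exists>f. spacelike_entire f \<and> C2 f \<and>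
            (\<exists>c>0. \<forall>p. \<forall>k\<in>principal_curvatures f p. c \<le> k) \<and>
            (\<exists>u. (\<forall>z\<in>ball 0 1. support_function (entire_graph f) z = ereal (u z)) \<and>
                 extends_boundary u \<phi>)"
proof -
  define q where "q t = \<phi> (cis t)" for t
  have cont: "continuous_on UNIV q"
    unfolding q_def by (intro continuous_on_compose2[OF \<phi>] continuous_intros) auto
  obtain Q where Q: "\<And>t. (Q has_real_derivative q t) (at t)" using continuous_has_antiderivative[OF cont] by blast
  have "continuous_on UNIV Q" using Q by (auto intro: DERIV_isCont continuous_at_imp_continuous_on)
  then obtain R where R: "\<And>t. (R has_real_derivative Q t) (at t)" using continuous_has_antiderivative by blast
  obtain C where C: "\<And>\<theta> h. \<bar>q (\<theta> + h) + q (\<theta> - h) - 2 * q \<theta>\<bar> \<le> C * \<bar>h\<bar>"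
    using assms(2) unfolding zygmund_def q_def by blast
  have "compact (\<phi> ` sphere 0 1)" using \<phi> by (intro compact_continuous_image) auto
  then obtain M where M: "\<forall>x\<in>\<phi> ` sphere 0 1. norm x \<le> M" using compact_imp_bounded bounded_iff by metis
  have "\<bar>q t\<bar> \<le> M" for t using M by (simp add: q_def)
  moreover have "q (t + 2 * pi) = q t" for t by (simp add: q_def flip: cis_mult)
  ultimately interpret zygmund_primitives q Q R C M
    using cont C Q R by unfold_locales auto
  define K where "K = 2592 * L"
  have K: "0 \<le> K" using C_nonneg M_nonneg by (simp add: K_def L_def)
  define u where "u z = extension z + (K + 1) * (- lapse z)" for z
  define g where "g z = grad_extension z + (K + 1) *\<^sub>R ((1 / lapse z) *\<^sub>R z)" for z
  define A where "A z w = hess_extension z w + (K + 1) *\<^sub>R hyp_hess z w" for z w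
  have du: "(u has_derivative inner (g z)) (at z)" if z: "z \<in> ball 0 1" for z
  proof -
    have "(u has_derivative (\<lambda>w. inner (grad_extension z) w + (K + 1) * inner ((1 / lapse z) *\<^sub>R z) w)) (at z)"
      unfolding u_def using z by (intro has_derivative_add extension_derivatives has_derivative_mult_right lapse_has_derivative) auto
    then show ?thesis by (rule has_derivative_eq_rhs) (simp add: g_def fun_eq_iff inner_add_left)
  qed
  have dg: "(g has_derivative A z) (at z)" if z: "z \<in> ball 0 1" for z
    unfolding g_def[abs_def] A_def[abs_def]
    using z by (intro has_derivative_add extension_derivatives has_derivative_scaleR_right hyp_hess_has_derivative) auto
  have cA: "continuous_on (ball 0 1) (\<lambda>z. A z w)" for w
  proof -
    have "continuous_on (ball 0 1) (\<lambda>z. hess_extension z w)"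
      using extension_derivatives(3) by (simp add: continuous_at_imp_continuous_on)
    moreover have "continuous_on (ball 0 1) (\<lambda>z. hyp_hess z w)"
      unfolding hyp_hess_def lapse_def
      by (intro continuous_intros) (use lapse_pos in \<open>force simp: lapse_def\<close>)+
    ultimately show ?thesis unfolding A_def by (intro continuous_intros)
  qed
  have form: "inner w (A z w) = inner w (hess_extension z w) + (K + 1) * inner w (hyp_hess z w)" for z w
    by (simp add: A_def inner_add_right)
  have b: "\<bar>inner w (hess_extension z w)\<bar> \<le> K * inner w (hyp_hess z w)" if "z \<in> ball 0 1" for z w
    using hess_extension_bound[OF that] by (simp add: K_def)
  have lower: "inner w (hyp_hess z w) \<le> inner w (A z w)" if "z \<in> ball 0 1" for z w
    using b[OF that, of w] unfolding form by (simp add: distrib_right abs_le_iff)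
  have upper: "inner w (A z w) \<le> (2 * K + 1) * inner w (hyp_hess z w)" if "z \<in> ball 0 1" for z w
    using b[OF that, of w] unfolding form by (simp add: distrib_right abs_le_iff)
  have K1: "0 < 2 * K + 1" using K by simp
  obtain f where f: "spacelike_entire f" "C2 f" "\<And>p k. k \<in> principal_curvatures f p \<Longrightarrow> 1 / (2 * K + 1) \<le> k"
    "\<And>z. z \<in> ball 0 1 \<Longrightarrow> support_function (entire_graph f) z = ereal (u z)"
    using entire_graph_with_support_function[OF du dg cA lower upper K1] by blast
  have "extends_boundary u \<phi>"
    unfolding extends_boundary_def
  proof (intro conjI ballI)
    have pos: "0 \<le> inner w (A z w)" if "z \<in> ball 0 1" for z w
      using lower[OF that, of w] hyp_hess_ge[of z w] that by (smt (verit) mem_ball_0 zero_le_power2)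
    show "convex_on (ball 0 1) u"
      by (rule convex_on_if_subgradients[OF convex_ball subgradient_inequality[OF convex_ball du dg pos]])
    fix z0 :: complex assume z0: "z0 \<in> sphere 0 1"
    have "(lapse \<longlongrightarrow> sqrt (1 - (norm z0)\<^sup>2)) (at z0 within ball 0 1)"
      unfolding lapse_def[abs_def] by (intro tendsto_intros)
    then have "(lapse \<longlongrightarrow> 0) (at z0 within ball 0 1)" using z0 by simp
    then have "(u \<longlongrightarrow> \<phi> z0 + (K + 1) * (- 0)) (at z0 within ball 0 1)"
      unfolding u_def[abs_def] by (intro tendsto_intros extension_tendsto_boundary[OF \<phi> q_def z0])
    then have "((\<lambda>z. ereal (u z)) \<longlongrightarrow> ereal (\<phi> z0)) (at z0 within ball 0 1)" by simp
    moreover have "z0 islimpt ball 0 1" using z0 by (simp add: islimpt_ball)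
    then have "at z0 within ball 0 1 \<noteq> bot" by (simp add: trivial_limit_within)
    ultimately show "ereal (\<phi> z0) = Liminf (at z0 within ball 0 1) (\<lambda>z. ereal (u z))"
      using lim_imp_Liminf by metis
  qed
  moreover have "\<exists>c>0. \<forall>p. \<forall>k\<in>principal_curvatures f p. c \<le> k"
    using f(3) K1 by (intro exI[of _ "1 / (2 * K + 1)"]) auto
  ultimately show ?thesis using f(1,2,4) by blast
qed

theorem theorem1p1:
  fixes \<phi> :: "complex \<Rightarrow> real"
  assumes "continuous_on (sphere 0 1) \<phi>"
  shows "(\<exists>f. spacelike_entire f \<and> C2 f \<and>
            (\<exists>c>0. \<forall>p. \<forall>k\<in>principal_curvatures f p. c \<le> k) \<and>
            (\<exists>u. (\<forall>z\<in>ball 0 1. support_function (entire_graph f) z = ereal (u z)) \<and>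
                 extends_boundary u \<phi>))
         \<longleftrightarrow> zygmund \<phi>"
  using zygmund_if_curvature_bounded_below[OF assms] curvature_bounded_below_if_zygmund[OF assms] by blast

end
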